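(* Let $K^\star\subset\mathbb{R}^d$ and $C\subset\mathbb{R}^q$ be (nonempty) compact convex sets, and suppose that $\mathrm{Aut}(C)$ is a subgroup of the orthogonal group $O(q,\mathbb{R})$. Let $(u^{(i)},y^{(i)})$, $i\ge 1$, be i.i.d. draws from the distribution $P_{K^\star}$ (defined in the context), and let $P_{n,K^\star}$ be the empirical measure of the first $n$ of them. Let $\{\hat A_n\}_{n=1}^\infty\subset L(\mathbb{R}^q,\mathbb{R}^d)$ be a sequence of minimizers of the empirical losses, i.e. $\hat A_n\in\mathrm{argmin}_{A}\Phi_C(A,P_{n,K^\star})$, and put $\hat K_n^C=\hat A_n(C)$. Then $$\mathrm{dist}(\hat A_n,M_{K^\star,C})\to 0\ \text{ a.s.}\qquad\text{and}\qquad \inf_{A\in M_{K^\star,C}} d_H\big(\hat A_n\cdot\mathrm{Aut}(C),\,A\cdot\mathrm{Aut}(C)\big)\to 0\ \text{ a.s.}$$ As a consequence, if $M_{K^\star,C}$ specifies a unique set, i.e. there exists $\hat K\subset\mathbb{R}^d$ such that $\hat K=A(C)$ for all $A\in M_{K^\star,C}$, then $\rho_p(\hat K_n^C,\hat K)\to0$ a.s. for every $1\le p\le\infty$. Further, if $K^\star=A^\star(C)$ for some $A^\star\in L(\mathbb{R}^q,\mathbb{R}^d)$, then $\rho_p(\hat K_n^C,K^\star)\to0$ a.s. for every $1\le p\le\infty$.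
   Context: $L(\mathbb{R}^q,\mathbb{R}^d)$ is the space of linear maps $\mathbb{R}^q\to\mathbb{R}^d$, with Euclidean (Frobenius) norm. $S^{d-1}$ is the unit sphere of $\mathbb{R}^d$. The support function of a compact convex set $K$ is $h_K(u)=\sup_{x\in K}\langle x,u\rangle$. $P_{K^\star}$ is the law of $(u,y)\in S^{d-1}\times\mathbb{R}$ with $y=h_{K^\star}(u)+\varepsilon$, where $u$ is uniform on $S^{d-1}$, $\varepsilon$ is independent of $u$, $\mathbb{E}[\varepsilon]=0$, $\mathbb{E}[\varepsilon^2]=\sigma^2<\infty$. For a probability measure $P$ on $S^{d-1}\times\mathbb{R}$, $\Phi_C(A,P):=\mathbb{E}_P[(h_C(A^Tu)-y)^2]$. Set $M_{K^\star,C}:=\mathrm{argmin}_{A\in L(\mathbb{R}^q,\mathbb{R}^d)}\Phi_C(A,P_{K^\star})$. $\mathrm{Aut}(C)$ is the set of linear transformations $g$ of $\mathbb{R}^q$ with $g(C)=C$; $A\cdot\mathrm{Aut}(C):=\{Ag : g\in\mathrm{Aut}(C)\}$. $\mathrm{dist}(a,U)=\inf_{b\in U}\|a-b\|$ with the Euclidean norm; $d_H$ is the Hausdorff distance with respect to the Euclidean norm. $\rho_p(K_1,K_2)=\big(\int_{S^{d-1}}|h_{K_1}(u)-h_{K_2}(u)|^p\,\mu(du)\big)^{1/p}$ for $1\le p<\infty$, with $\mu$ the Lebesgue measure on $S^{d-1}$, and $\rho_\infty(K_1,K_2)=\max_{u\in S^{d-1}}|h_{K_1}(u)-h_{K_2}(u)|$.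 *)

theory Defs
  imports "HOL-Probability.Probability" "HOL-Algebra.Group"
begin

text \<open>Linear maps from \<open>\<real>\<^sup>q\<close> to \<open>\<real>\<^sup>d\<close> are represented by their matrices in
  \<^typ>\<open>real^'q^'d\<close>; the norm of that type is the Frobenius norm.\<close>

definition support_fun :: "(real^'d) set \<Rightarrow> real^'d \<Rightarrow> real" where
  "support_fun K u = (SUP x\<in>K. x \<bullet> u)"

text \<open>Lebesgue surface measure on the unit sphere via polar coordinates: the surface measure of
  \<open>E\<close> is \<open>d\<close> times the Lebesgue measure of \<open>{t u | u \<in> E, 0 < t \<le> 1}\<close>.\<close>

definition sphere_measure :: "(real^'d) measure" where
  "sphere_measure =
     scale_measure (of_nat CARD('d))
       (distr (restrict_space lborel (cball 0 1 - {0})) (restrict_space borel (sphere 0 1)) sgn)"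

definition uniform_sphere :: "(real^'d) measure" where
  "uniform_sphere = uniform_measure sphere_measure (sphere 0 1)"

definition obs_space :: "((real^'d) \<times> real) measure" where
  "obs_space = restrict_space borel (sphere 0 1) \<Otimes>\<^sub>M borel"

text \<open>The law of \<open>(u, h\<^sub>K(u) + \<epsilon>)\<close> for \<open>u\<close> uniform on the sphere and \<open>\<epsilon>\<close> independent of \<open>u\<close>
  with law \<open>\<nu>\<close>.\<close>

definition obs_law :: "(real^'d) set \<Rightarrow> real measure \<Rightarrow> ((real^'d) \<times> real) measure" where
  "obs_law K \<nu> =
     distr (uniform_sphere \<Otimes>\<^sub>M \<nu>) obs_space (\<lambda>(u, e). (u, support_fun K u + e))"

text \<open>Draws are indexed from 0, so the first \<open>n\<close> draws are those with index below \<open>n\<close>.\<close>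

definition empirical_measure ::
    "nat \<Rightarrow> (nat \<Rightarrow> (real^'d) \<times> real) \<Rightarrow> ((real^'d) \<times> real) measure" where
  "empirical_measure n x = distr (uniform_count_measure {..<n}) obs_space x"

definition loss :: "(real^'q) set \<Rightarrow> real^'q^'d \<Rightarrow> ((real^'d) \<times> real) measure \<Rightarrow> real" where
  "loss C A P = (LINT (u, y)|P. (support_fun C (transpose A *v u) - y)\<^sup>2)"

definition minimizers ::
    "(real^'q) set \<Rightarrow> ((real^'d) \<times> real) measure \<Rightarrow> (real^'q^'d) set" where
  "minimizers C P = {A. is_arg_min (\<lambda>A. loss C A P) (\<lambda>_. True) A}"

definition Aut :: "(real^'q) set \<Rightarrow> (real^'q^'q) set" where
  "Aut C = {g. (*v) g ` C = C}"

definition orthogonal_group_mat :: "(real^'q^'q) monoid" where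
  "orthogonal_group_mat = \<lparr>carrier = {Q. orthogonal_matrix Q}, mult = (**), one = mat 1\<rparr>"

definition orbit_Aut :: "(real^'q) set \<Rightarrow> real^'q^'d \<Rightarrow> (real^'q^'d) set" where
  "orbit_Aut C A = (\<lambda>g. A ** g) ` Aut C"

definition hausdorff_dist :: "'a::metric_space set \<Rightarrow> 'a set \<Rightarrow> real" where
  "hausdorff_dist S T = max (SUP s\<in>S. infdist s T) (SUP t\<in>T. infdist t S)"

definition rho :: "ereal \<Rightarrow> (real^'d) set \<Rightarrow> (real^'d) set \<Rightarrow> real" where
  "rho p K L =
     (if p = \<infinity> then (SUP u\<in>sphere 0 1. \<bar>support_fun K u - support_fun L u\<bar>)
      else (LINT u|sphere_measure. \<bar>support_fun K u - support_fun L u\<bar> powr real_of_ereal p)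
             powr (1 / real_of_ereal p))"

end

theory Submission
  imports Defs "HOL-Library.Discrete_Functions" "HOL-Real_Asymp.Real_Asymp"
begin

text \<open>Up to the summand \<open>E[y\<^sup>2]\<close>, which does not depend on \<open>A\<close>, the loss is \<open>Q(A) - 2 L(A)\<close>
  with \<open>Q(A) = E[h\<^sub>C(A\<^sup>T u)\<^sup>2]\<close> and \<open>L(A) = E[h\<^sub>C(A\<^sup>T u) y]\<close>. Dropping \<open>E[y\<^sup>2]\<close> leaves only
  averages of square integrable variables, for which the strong law is elementary.
  Since \<open>A \<mapsto> h\<^sub>C(A\<^sup>T u)\<close> is Lipschitz, the strong law on a countable dense set of \<open>A\<close> gives almost
  sure locally uniform convergence of the empirical versions of \<open>Q\<close> and \<open>L\<close>.
  Orthogonality of \<open>Aut C\<close> forces \<open>C\<close> to span the space, hence \<open>Q\<close> is positive away from \<open>0\<close>;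
  as \<open>Q\<close> is homogeneous of degree 2 and \<open>L\<close> of degree 1, empirical minimizers stay bounded, and
  their limit points minimize the population loss. Orthogonality also makes right multiplication by
  \<open>Aut C\<close> isometric, and the Lipschitz bound turns the distance to the minimizers into a bound for
  \<open>\<rho>\<^sub>p\<close>. When \<open>K\<^sup>\<star> = A\<^sup>\<star>(C)\<close>, every minimizer has zero excess risk, so its support function agrees
  with that of \<open>K\<^sup>\<star>\<close> almost everywhere and, by continuity, on the whole sphere.\<close>

subsection \<open>Strong and uniform laws of large numbers\<close>

text \<open>With k the integer square root of n, k^2 <= n <= (k+1)^2, so monotonicity squeezes S n /
  n between S (k^2) / (k+1)^2 and S ((k+1)^2) / k^2. Since (k+1)^2 / k^2 tends to 1, both bounds
  inherit the limit along the squares.\<close>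

lemma mean_tendsto_from_squares:
  fixes S :: "nat \<Rightarrow> real"
  assumes mono: "mono S" and nonneg: "\<And>n. 0 \<le> S n"
    and lim: "(\<lambda>k. S ((Suc k)\<^sup>2) / (real (Suc k))\<^sup>2) \<longlonglongrightarrow> m"
  shows "(\<lambda>n. S n / real n) \<longlonglongrightarrow> m"
proof -
  have lim0: "(\<lambda>k. S (k\<^sup>2) / (real k)\<^sup>2) \<longlonglongrightarrow> m"
    using lim by (subst filterlim_sequentially_Suc[symmetric]) simp
  have r1: "(\<lambda>k. (real k)\<^sup>2 / (real (Suc k))\<^sup>2) \<longlonglongrightarrow> 1"
    and r2: "(\<lambda>k. (real (Suc k))\<^sup>2 / (real k)\<^sup>2) \<longlonglongrightarrow> 1"
    by real_asymp+
  have "(\<lambda>k. S (k\<^sup>2) / (real k)\<^sup>2 * ((real k)\<^sup>2 / (real (Suc k))\<^sup>2)) \<longlonglongrightarrow> m"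
    using tendsto_mult[OF lim0 r1] by (simp del: of_nat_Suc)
  then have lo: "(\<lambda>k. S (k\<^sup>2) / (real (Suc k))\<^sup>2) \<longlonglongrightarrow> m"
  proof (rule Lim_transform_eventually)
    show "\<forall>\<^sub>F k in sequentially. S (k\<^sup>2) / (real k)\<^sup>2 * ((real k)\<^sup>2 / (real (Suc k))\<^sup>2)
        = S (k\<^sup>2) / (real (Suc k))\<^sup>2"
      using eventually_gt_at_top[of 0] by eventually_elim simp
  qed
  have "(\<lambda>k. S ((Suc k)\<^sup>2) / (real (Suc k))\<^sup>2 * ((real (Suc k))\<^sup>2 / (real k)\<^sup>2)) \<longlonglongrightarrow> m * 1"
    by (intro tendsto_mult lim r2)
  then have hi: "(\<lambda>k. S ((Suc k)\<^sup>2) / (real k)\<^sup>2) \<longlonglongrightarrow> m"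
    by simp
  have sq: "filterlim floor_sqrt at_top sequentially"
    unfolding filterlim_at_top
  proof
    fix Z
    show "\<forall>\<^sub>F n in sequentially. Z \<le> floor_sqrt n"
      using eventually_ge_at_top[of "Z\<^sup>2"] by eventually_elim (simp add: le_floor_sqrtI)
  qed
  show ?thesis
  proof (rule tendsto_sandwich[OF _ _ filterlim_compose[OF lo sq] filterlim_compose[OF hi sq]])
    show "\<forall>\<^sub>F n in sequentially. S ((floor_sqrt n)\<^sup>2) / (real (Suc (floor_sqrt n)))\<^sup>2 \<le> S n / real n"
      using eventually_gt_at_top[of 0]
    proof eventually_elim
      case (elim n)
      have "n \<le> (Suc (floor_sqrt n))\<^sup>2"
        using Suc_floor_sqrt_power2_gt[of n] by simp
      then have "real n \<le> (real (Suc (floor_sqrt n)))\<^sup>2"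
        by (metis of_nat_le_iff of_nat_power)
      then show ?case
        using elim nonneg by (intro frac_le monoD[OF mono]) auto
    qed
    show "\<forall>\<^sub>F n in sequentially. S n / real n \<le> S ((Suc (floor_sqrt n))\<^sup>2) / (real (floor_sqrt n))\<^sup>2"
      using eventually_gt_at_top[of 0]
    proof eventually_elim
      case (elim n)
      have "(floor_sqrt n)\<^sup>2 \<le> n" "n \<le> (Suc (floor_sqrt n))\<^sup>2"
        using Suc_floor_sqrt_power2_gt[of n] by auto
      moreover from this have "(real (floor_sqrt n))\<^sup>2 \<le> real n"
        by (metis of_nat_le_iff of_nat_power)
      moreover have "0 < floor_sqrt n" using elim by simp
      ultimately show ?case
        using elim nonneg by (intro frac_le monoD[OF mono]) auto
    qed
  qed
qed

context prob_space
begin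

text \<open>Expanding the square of the centred sum leaves only the n diagonal terms, each the
  variance s - m^2, because independence annihilates the mixed expectations. Integrability is part
  of the conclusion since the Bochner integral of a nonintegrable function is 0 by
  convention.\<close>

lemma variance_sum_indep:
  fixes Z :: "nat \<Rightarrow> 'a \<Rightarrow> real"
  assumes indep: "indep_vars (\<lambda>_. borel) Z UNIV"
    and int2: "\<And>i. integrable M (\<lambda>x. (Z i x)\<^sup>2)"
    and mean: "\<And>i. expectation (Z i) = m"
    and second: "\<And>i. expectation (\<lambda>x. (Z i x)\<^sup>2) = s"
  shows "integrable M (\<lambda>x. ((\<Sum>i<n. Z i x) - real n * m)\<^sup>2)"
    and "expectation (\<lambda>x. ((\<Sum>i<n. Z i x) - real n * m)\<^sup>2) = real n * (s - m\<^sup>2)"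
proof -
  have rv[measurable]: "Z i \<in> borel_measurable M" for i
    using indep by (auto simp: indep_vars_def)
  have int: "integrable M (Z i)" for i
    using int2 by (rule square_integrable_imp_integrable[rotated]) simp
  define Y where "Y = (\<lambda>i x. Z i x - m)"
  have indepY: "indep_vars (\<lambda>_. borel) Y UNIV"
    unfolding Y_def by (rule indep_vars_compose2[OF indep]) simp
  have intY: "integrable M (Y i)" for i
    unfolding Y_def using int by simp
  have sqY: "(Y i x)\<^sup>2 = (Z i x)\<^sup>2 - 2 * m * Z i x + m\<^sup>2" for i x
    by (simp add: Y_def power2_eq_square algebra_simps)
  have meanY: "expectation (Y i) = 0" for i
    unfolding Y_def using int by (simp add: mean prob_space)
  have YY: "integrable M (\<lambda>x. Y i x * Y j x) \<and>
      expectation (\<lambda>x. Y i x * Y j x) = (if i = j then s - m\<^sup>2 else 0)" for i j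
  proof (cases "i = j")
    case True
    have "integrable M (\<lambda>x. (Y i x)\<^sup>2)"
      unfolding sqY using int int2 by simp
    moreover have "expectation (\<lambda>x. (Y i x)\<^sup>2) = s - m\<^sup>2"
      unfolding sqY using int int2 by (simp add: mean second prob_space) (simp add: power2_eq_square)
    ultimately show ?thesis using True by (simp add: power2_eq_square)
  next
    case False
    \<comment> \<open>A product over the two-element set {i, j} brings the mixed term into the form
      of the product rule for \<open>indep_vars\<close>.\<close>
    have iv: "indep_vars (\<lambda>_. borel) Y {i, j}"
      using indepY by (rule indep_vars_subset) simp
    have "integrable M (\<lambda>x. \<Prod>k\<in>{i,j}. Y k x)"
      by (rule indep_vars_integrable[OF _ iv]) (use intY in auto)
    moreover have "expectation (\<lambda>x. \<Prod>k\<in>{i,j}. Y k x) = (\<Prod>k\<in>{i,j}. expectation (Y k))"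
      by (rule indep_vars_lebesgue_integral[OF _ iv]) (use intY in auto)
    ultimately show ?thesis using False meanY by simp
  qed
  have eq: "((\<Sum>i<n. Z i x) - real n * m)\<^sup>2 = (\<Sum>i<n. \<Sum>j<n. Y i x * Y j x)" for x
    by (simp add: Y_def sum_subtractf power2_eq_square flip: sum_product)
  show "integrable M (\<lambda>x. ((\<Sum>i<n. Z i x) - real n * m)\<^sup>2)"
    unfolding eq using YY by simp
  show "expectation (\<lambda>x. ((\<Sum>i<n. Z i x) - real n * m)\<^sup>2) = real n * (s - m\<^sup>2)"
    unfolding eq using YY by (simp add: Bochner_Integration.integral_sum)
qed

text \<open>Along the squares \<open>n = k\<^sup>2\<close> the variances of the means are summable, which gives almost sure
  convergence; monotonicity of the partial sums fills the gaps between consecutive squares.\<close>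

lemma strong_law_nonneg:
  fixes Z :: "nat \<Rightarrow> 'a \<Rightarrow> real"
  assumes indep: "indep_vars (\<lambda>_. borel) Z UNIV"
    and int2: "\<And>i. integrable M (\<lambda>x. (Z i x)\<^sup>2)"
    and mean: "\<And>i. expectation (Z i) = m"
    and second: "\<And>i. expectation (\<lambda>x. (Z i x)\<^sup>2) = s"
    and nonneg: "\<And>i x. 0 \<le> Z i x"
  shows "AE x in M. (\<lambda>n. (\<Sum>i<n. Z i x) / real n) \<longlonglongrightarrow> m"
proof -
  have rv[measurable]: "Z i \<in> borel_measurable M" for i
    using indep by (auto simp: indep_vars_def)
  define D where "D k x = ((\<Sum>i<(Suc k)\<^sup>2. Z i x) / (real (Suc k))\<^sup>2 - m)\<^sup>2" for k x
  have [measurable]: "D k \<in> borel_measurable M" for k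
    unfolding D_def by measurable
  have D: "D k x = ((\<Sum>i<(Suc k)\<^sup>2. Z i x) - real ((Suc k)\<^sup>2) * m)\<^sup>2 / (real (Suc k)) ^ 4" for k x
  proof -
    have "(a / r\<^sup>2 - m)\<^sup>2 = (a - r\<^sup>2 * m)\<^sup>2 / r ^ 4" if "r > 0" for a r :: real
      using that by (simp add: field_simps power2_eq_square power4_eq_xxxx)
    from this[of "real (Suc k)"] show ?thesis
      unfolding D_def of_nat_power by simp
  qed
  have intD: "integrable M (D k)" for k
    unfolding D by (intro integrable_divide_zero variance_sum_indep(1)[OF indep int2 mean second])
  have expD: "expectation (D k) = (s - m\<^sup>2) * (1 / (real (Suc k))\<^sup>2)" for k
  proof -
    have "r\<^sup>2 * v / r ^ 4 = v * (1 / r\<^sup>2)" if "r > 0" for r v :: real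
      using that by (simp add: field_simps power2_eq_square power4_eq_xxxx)
    from this[of "real (Suc k)"] show ?thesis
      unfolding D integral_divide_zero variance_sum_indep(2)[OF indep int2 mean second]
      unfolding of_nat_power by simp
  qed
  have sum: "summable (\<lambda>k. expectation (D k))"
    unfolding expD
  proof (rule summable_mult)
    have "summable (\<lambda>k. inverse ((real k)\<^sup>2))"
      by (rule inverse_power_summable) simp
    then show "summable (\<lambda>k. 1 / (real (Suc k))\<^sup>2)"
      by (subst (asm) summable_Suc_iff[symmetric]) (simp only: inverse_eq_divide)
  qed
  have Dnn: "0 \<le> D k x" for k x
    by (simp add: D_def)
  \<comment> \<open>The sum of the squared errors has finite expectation, so it is finite almost
    surely and its terms tend to 0. This replaces Chebyshev's inequality and Borel-Cantelli.\<close>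
  have "(\<integral>\<^sup>+x. (\<Sum>k. ennreal (D k x)) \<partial>M) = (\<Sum>k. \<integral>\<^sup>+x. ennreal (D k x) \<partial>M)"
    by (rule nn_integral_suminf) simp
  also have "\<dots> = (\<Sum>k. ennreal (expectation (D k)))"
    using intD Dnn by (simp add: nn_integral_eq_integral)
  also have "\<dots> \<noteq> \<infinity>"
    using sum Dnn by (simp add: suminf_ennreal_eq[OF _ summable_sums])
  finally have "AE x in M. (\<Sum>k. ennreal (D k x)) \<noteq> \<infinity>"
    by (intro nn_integral_PInf_AE) auto
  then show ?thesis
  proof eventually_elim
    case (elim x)
    have "summable (\<lambda>k. D k x)"
      using elim Dnn by (intro summable_suminf_not_top) auto
    then have "(\<lambda>k. D k x) \<longlonglongrightarrow> 0"
      by (rule summable_LIMSEQ_zero)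
    then have "(\<lambda>k. sqrt (D k x)) \<longlonglongrightarrow> 0"
      using tendsto_real_sqrt by fastforce
    then have "(\<lambda>k. (\<Sum>i<(Suc k)\<^sup>2. Z i x) / (real (Suc k))\<^sup>2 - m) \<longlonglongrightarrow> 0"
      unfolding D_def by (simp add: tendsto_rabs_zero_iff)
    then have "(\<lambda>k. (\<Sum>i<(Suc k)\<^sup>2. Z i x) / (real (Suc k))\<^sup>2) \<longlonglongrightarrow> m"
      by (simp add: LIM_zero_iff)
    then show ?case
      by (intro mean_tendsto_from_squares)
        (auto simp: mono_def nonneg intro!: sum_mono2 sum_nonneg)
  qed
qed

text \<open>The positive and negative parts of \<open>\<phi>\<close> are dominated by its absolute
  value, hence square integrable, and the nonnegative case applies to each.\<close>

theorem strong_law_iid: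
  fixes \<phi> :: "'b \<Rightarrow> real"
  assumes indep: "indep_vars (\<lambda>_. N) X UNIV"
    and law: "\<And>i. distr M N (X i) = P"
    and \<phi>[measurable]: "\<phi> \<in> borel_measurable N"
    and int2: "integrable P (\<lambda>z. (\<phi> z)\<^sup>2)"
  shows "AE x in M. (\<lambda>n. (\<Sum>i<n. \<phi> (X i x)) / real n) \<longlonglongrightarrow> (LINT z|P. \<phi> z)"
proof -
  have rv[measurable]: "X i \<in> measurable M N" for i
    using indep by (auto simp: indep_vars_def)
  have P: "prob_space P"
    using prob_space_distr[OF rv[of 0]] law by simp
  have [measurable_cong]: "sets P = sets N"
    using law[of 0] by auto
  have int: "integrable P \<phi>"
    by (rule finite_measure.square_integrable_imp_integrable[OF prob_space.finite_measure[OF P] _ int2]) measurable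
  have part: "AE x in M. (\<lambda>n. (\<Sum>i<n. \<psi> (X i x)) / real n) \<longlonglongrightarrow> (LINT z|P. \<psi> z)"
    if [measurable]: "\<psi> \<in> borel_measurable N" and nn: "\<And>z. 0 \<le> \<psi> z" and le: "\<And>z. \<bar>\<psi> z\<bar> \<le> \<bar>\<phi> z\<bar>" for \<psi>
  proof (rule strong_law_nonneg)
    have "integrable P (\<lambda>z. (\<psi> z)\<^sup>2)"
      by (rule Bochner_Integration.integrable_bound[OF int2]) (auto simp: abs_le_square_iff[symmetric] le)
    then show "integrable M (\<lambda>x. (\<psi> (X i x))\<^sup>2)" for i
      by (simp add: integrable_distr_eq flip: law[of i])
    show "indep_vars (\<lambda>_. borel) (\<lambda>i x. \<psi> (X i x)) UNIV"
      by (rule indep_vars_compose2[OF indep]) simp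
    show "expectation (\<lambda>x. \<psi> (X i x)) = (LINT z|P. \<psi> z)" for i
      by (simp add: integral_distr flip: law[of i])
    show "expectation (\<lambda>x. (\<psi> (X i x))\<^sup>2) = (LINT z|P. (\<psi> z)\<^sup>2)" for i
      by (simp add: integral_distr flip: law[of i])
  qed (rule nn)
  have "AE x in M. (\<lambda>n. (\<Sum>i<n. max 0 (\<phi> (X i x))) / real n) \<longlonglongrightarrow> (LINT z|P. max 0 (\<phi> z))"
    by (rule part) auto
  moreover have "AE x in M. (\<lambda>n. (\<Sum>i<n. max 0 (- \<phi> (X i x))) / real n) \<longlonglongrightarrow> (LINT z|P. max 0 (- \<phi> z))"
    by (rule part) auto
  ultimately show ?thesis
  proof eventually_elim
    case (elim x)
    have dec: "max 0 r - max 0 (- r) = r" for r :: real by simp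
    have "(LINT z|P. max 0 (\<phi> z)) - (LINT z|P. max 0 (- \<phi> z)) = (LINT z|P. \<phi> z)"
      using int by (subst Bochner_Integration.integral_diff[symmetric]) (auto simp: dec)
    then show ?case
      using tendsto_diff[OF elim] by (simp add: dec flip: diff_divide_distrib sum_subtractf)
  qed
qed

end

text \<open>Convergence along the product filter lets the argument B move towards A while n grows,
  as needed for sample dependent minimizers. One null set serves all A: the strong law is used only
  for a countable dense set of parameters and for the weight \<open>w\<close>, and the Lipschitz
  estimate covers the rest. Its factor 1 + norm A + norm B admits quadratic dependence on the
  parameter.\<close>

lemma (in prob_space) uniform_law_iid:
  fixes \<phi> :: "'c::{real_normed_vector, second_countable_topology} \<Rightarrow> 'b \<Rightarrow> real"
  assumes indep: "indep_vars (\<lambda>_. N) X UNIV"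
    and law: "\<And>i. distr M N (X i) = P"
    and \<phi>: "\<And>A. \<phi> A \<in> borel_measurable N" "\<And>A. integrable P (\<lambda>z. (\<phi> A z)\<^sup>2)"
    and w: "w \<in> borel_measurable N" "integrable P (\<lambda>z. (w z)\<^sup>2)"
    and lip: "\<And>A B z. z \<in> space N \<Longrightarrow> \<bar>\<phi> A z - \<phi> B z\<bar> \<le> norm (A - B) * (1 + norm A + norm B) * w z"
    and w_nonneg: "\<And>z. z \<in> space N \<Longrightarrow> 0 \<le> w z"
  shows "AE x in M. \<forall>A. ((\<lambda>(n, B). (\<Sum>i<n. \<phi> B (X i x)) / real n) \<longlongrightarrow> (LINT z|P. \<phi> A z))
    (sequentially \<times>\<^sub>F nhds A)"
proof -
  have rv[measurable]: "X i \<in> measurable M N" for i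
    using indep by (auto simp: indep_vars_def)
  have P: "prob_space P"
    using prob_space_distr[OF rv[of 0]] law by simp
  have setsP[measurable_cong]: "sets P = sets N"
    using law[of 0] by auto
  have spaceP: "space P = space N"
    by (rule sets_eq_imp_space_eq) (rule setsP)
  have [measurable]: "\<phi> A \<in> borel_measurable N" for A by (rule \<phi>)
  have [measurable]: "w \<in> borel_measurable N" by (rule w)
  have int\<phi>: "integrable P (\<phi> A)" for A
    by (rule finite_measure.square_integrable_imp_integrable[OF prob_space.finite_measure[OF P] _ \<phi>(2)]) measurable
  have intw: "integrable P w"
    by (rule finite_measure.square_integrable_imp_integrable[OF prob_space.finite_measure[OF P] _ w(2)]) measurable
  define F where "F A = (LINT z|P. \<phi> A z)" for A
  define W where "W = (LINT z|P. w z)"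
  have W_nonneg: "0 \<le> W"
    unfolding W_def using w_nonneg by (intro Bochner_Integration.integral_nonneg_AE AE_I2) (simp add: spaceP)
  have lipF: "\<bar>F A - F B\<bar> \<le> norm (A - B) * (1 + norm A + norm B) * W" for A B
  proof -
    have "\<bar>F A - F B\<bar> = \<bar>LINT z|P. \<phi> A z - \<phi> B z\<bar>"
      unfolding F_def using int\<phi> by simp
    also have "\<dots> \<le> (LINT z|P. \<bar>\<phi> A z - \<phi> B z\<bar>)"
      by (rule integral_abs_bound)
    also have "\<dots> \<le> (LINT z|P. norm (A - B) * (1 + norm A + norm B) * w z)"
      using int\<phi> intw lip by (intro integral_mono) (auto simp: spaceP)
    finally show ?thesis unfolding W_def by simp
  qed
  obtain D :: "'c set" where D: "countable D" "\<And>U. open U \<Longrightarrow> U \<noteq> {} \<Longrightarrow> \<exists>d\<in>D. d \<in> U"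
    using countable_dense_setE by blast
  have "AE x in M. \<forall>d\<in>D. (\<lambda>n. (\<Sum>i<n. \<phi> d (X i x)) / real n) \<longlonglongrightarrow> F d"
    unfolding F_def using D(1) \<phi> by (intro AE_ball_countable' strong_law_iid[OF indep law]) auto
  moreover have "AE x in M. (\<lambda>n. (\<Sum>i<n. w (X i x)) / real n) \<longlonglongrightarrow> W"
    unfolding W_def using w by (intro strong_law_iid[OF indep law]) auto
  ultimately show ?thesis
    using AE_space
  proof eventually_elim
    case (elim x)
    define Fn where "Fn n B = (\<Sum>i<n. \<phi> B (X i x)) / real n" for n B
    define Wn where "Wn n = (\<Sum>i<n. w (X i x)) / real n" for n
    have XN: "X i x \<in> space N" for i
      using measurable_space[OF rv] elim by blast
    have lipn: "\<bar>Fn n A - Fn n B\<bar> \<le> norm (A - B) * (1 + norm A + norm B) * Wn n" for n A B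
    proof -
      have "\<bar>Fn n A - Fn n B\<bar> = \<bar>\<Sum>i<n. \<phi> A (X i x) - \<phi> B (X i x)\<bar> / real n"
        unfolding Fn_def by (simp add: sum_subtractf abs_divide flip: diff_divide_distrib)
      also have "\<dots> \<le> (\<Sum>i<n. norm (A - B) * (1 + norm A + norm B) * w (X i x)) / real n"
        by (intro divide_right_mono order_trans[OF sum_abs] sum_mono lip XN) simp
      finally show ?thesis unfolding Wn_def by (simp add: sum_distrib_left)
    qed
    show ?case
    proof (rule allI, rule tendstoI)
      fix A :: 'c and e :: real
      assume e: "0 < e"
      \<comment> \<open>Two points within \<open>\<delta>\<close> <= 1 of A are at most 2
        \<open>\<delta>\<close> apart and have norm at most 1 + norm A. Hence the Lipschitz bound
        with a weight of at most W + 1 does not exceed \<open>\<delta>\<close> K <= e / 3.\<close>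
      define K where "K = 2 * (3 + 2 * norm A) * (W + 1)"
      have K: "0 < K" unfolding K_def using W_nonneg by (intro mult_pos_pos) (auto intro: add_pos_nonneg)
      define \<delta> where "\<delta> = min 1 (e / (3 * K))"
      have \<delta>: "0 < \<delta>" "\<delta> \<le> 1" "\<delta> * K \<le> e / 3"
        using e K by (auto simp: \<delta>_def field_simps min_def)
      have bound: "norm (B - B') * (1 + norm B + norm B') * V \<le> e / 3"
        if B: "dist B A < \<delta>" "dist B' A < \<delta>" and V: "0 \<le> V" "V \<le> W + 1" for B B' V
      proof -
        have "norm (B - B') \<le> 2 * \<delta>"
          using dist_triangle_lt[of B A B' "2 * \<delta>"] B by (simp add: dist_norm norm_minus_commute)
        moreover have "norm B \<le> 1 + norm A" "norm B' \<le> 1 + norm A"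
          using B \<delta>(2) norm_triangle_ineq2[of B A] norm_triangle_ineq2[of B' A] by (auto simp: dist_norm)
        ultimately have "norm (B - B') * (1 + norm B + norm B') * V \<le> (2 * \<delta>) * (3 + 2 * norm A) * (W + 1)"
          using V \<delta> by (intro mult_mono) auto
        also have "\<dots> = \<delta> * K" by (simp add: K_def)
        finally show ?thesis using \<delta> by simp
      qed
      \<comment> \<open>The error at B is split at a dense point d: from B to d for the empirical
        mean, from empirical to true mean at d, and from d to A for the true mean. Each piece
        contributes at most e / 3.\<close>
      obtain d where d: "d \<in> D" "dist d A < \<delta>"
        using D(2)[of "ball A \<delta>"] \<delta>(1) by (auto simp: dist_commute)
      have "\<forall>\<^sub>F n in sequentially. dist (Fn n d) (F d) < e / 3"
        using elim(1) d(1) e unfolding Fn_def by (intro tendstoD) auto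
      moreover have "\<forall>\<^sub>F n in sequentially. dist (Wn n) W < 1"
        using elim(2) unfolding Wn_def by (intro tendstoD) auto
      ultimately have "\<forall>\<^sub>F n in sequentially. dist (Fn n d) (F d) < e / 3 \<and> Wn n \<le> W + 1"
        by eventually_elim (auto simp: dist_real_def)
      moreover have "\<forall>\<^sub>F B in nhds A. dist B A < \<delta>"
        using \<delta>(1) by (auto simp: eventually_nhds_metric)
      ultimately have "\<forall>\<^sub>F p in sequentially \<times>\<^sub>F nhds A.
          (dist (Fn (fst p) d) (F d) < e / 3 \<and> Wn (fst p) \<le> W + 1) \<and> dist (snd p) A < \<delta>"
        by (rule eventually_prodI)
      then show "\<forall>\<^sub>F p in sequentially \<times>\<^sub>F nhds A.
          dist (case p of (n, B) \<Rightarrow> (\<Sum>i<n. \<phi> B (X i x)) / real n) (LINT z|P. \<phi> A z) < e"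
      proof eventually_elim
        case (elim p)
        obtain n B where p: "p = (n, B)" by (cases p)
        have "0 \<le> Wn n"
          unfolding Wn_def using XN by (intro divide_nonneg_nonneg sum_nonneg w_nonneg) auto
        then have "\<bar>Fn n B - Fn n d\<bar> \<le> e / 3"
          using lipn[of n B d] bound[of B d "Wn n"] elim d(2) by (auto simp: p)
        moreover have "\<bar>F d - F A\<bar> \<le> e / 3"
          using lipF[of d A] bound[of d A W] \<delta> d(2) W_nonneg by auto
        moreover have "\<bar>Fn n d - F d\<bar> < e / 3"
          using elim by (auto simp: p dist_real_def)
        ultimately have "\<bar>Fn n B - F A\<bar> < e" by linarith
        then show ?case by (simp add: p Fn_def F_def dist_real_def)
      qed
    qed
  qed
qed

subsection \<open>Consistency of minimizers\<close>

text \<open>Minimizers stay bounded because a rescaled unbounded subsequence would have a limit on the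
  unit sphere at which \<open>Q\<close> is not positive.\<close>

lemma argmin_consistent:
  fixes Q P :: "'c::euclidean_space \<Rightarrow> real"
  assumes Q: "\<And>A. ((\<lambda>(n, B). Qn n B) \<longlongrightarrow> Q A) (sequentially \<times>\<^sub>F nhds A)"
    and P: "\<And>A. ((\<lambda>(n, B). Pn n B) \<longlongrightarrow> P A) (sequentially \<times>\<^sub>F nhds A)"
    and Q_hom: "\<And>n t A. 0 \<le> t \<Longrightarrow> Qn n (t *\<^sub>R A) = t\<^sup>2 * Qn n A"
    and P_hom: "\<And>n t A. 0 \<le> t \<Longrightarrow> Pn n (t *\<^sub>R A) = t * Pn n A"
    and pos: "\<And>A. A \<noteq> 0 \<Longrightarrow> 0 < Q A"
    and min: "\<And>n B. 1 \<le> n \<Longrightarrow> Qn n (a n) - 2 * Pn n (a n) \<le> Qn n B - 2 * Pn n B"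
  defines "S \<equiv> {A. \<forall>B. Q A - 2 * P A \<le> Q B - 2 * P B}"
  shows "S \<noteq> {}" and "(\<lambda>n. infdist (a n) S) \<longlonglongrightarrow> 0"
proof -
  have comp: "(\<lambda>k. Gn (r k) (b k)) \<longlonglongrightarrow> G A"
    if "\<And>A. ((\<lambda>(n, B). Gn n B) \<longlongrightarrow> G A) (sequentially \<times>\<^sub>F nhds A)"
      and "filterlim r at_top sequentially" "b \<longlonglongrightarrow> A" for Gn :: "nat \<Rightarrow> 'c \<Rightarrow> real" and G r b A
    using filterlim_compose[OF that(1) filterlim_Pair[OF that(2,3)]] by simp
  \<comment> \<open>The sequence \<open>r\<close> is not claimed to be increasing. The bound r k >=
    k + 1 alone sends it to infinity, and it keeps r k >= 1, where \<open>min\<close>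
    applies.\<close>
  have inf_many: "\<exists>r. (\<forall>k. Suc k \<le> r k \<and> R k (r k))"
    if "\<And>k. \<exists>\<^sub>F n in sequentially. R k n" for R :: "nat \<Rightarrow> nat \<Rightarrow> bool"
    by (intro choice allI) (use that in \<open>auto simp: frequently_sequentially\<close>)
  have to_top: "filterlim (\<lambda>k. r (s k)) at_top sequentially"
    if "\<And>k. Suc k \<le> r k" "strict_mono s" for r s :: "nat \<Rightarrow> nat"
  proof (rule filterlim_at_top_mono[OF filterlim_ident])
    show "\<forall>\<^sub>F k in sequentially. k \<le> r (s k)"
      using that by (intro always_eventually allI) (meson Suc_leD le_trans seq_suble)
  qed
  have bdd: "Bseq a"
  proof (rule ccontr)
    assume "\<not> Bseq a"
    then have "\<exists>\<^sub>F n in sequentially. \<not> norm (a n) \<le> real (Suc k)" for k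
      using BfunI[of a "real (Suc k)" sequentially] by (auto simp: frequently_def)
    then obtain r where r: "\<And>k. Suc k \<le> r k" "\<And>k. \<not> norm (a (r k)) \<le> real (Suc k)"
      using inf_many[of "\<lambda>k n. \<not> norm (a n) \<le> real (Suc k)"] by auto
    define t where "t k = norm (a (r k))" for k
    have t: "real (Suc k) < t k" for k
      using r(2)[of k] by (simp add: t_def)
    then have t_pos: "0 < t k" for k
      using of_nat_0_le_iff order_le_less_trans by blast
    define u where "u k = (1 / t k) *\<^sub>R a (r k)" for k
    have "u k \<in> sphere 0 1" for k
      using t_pos[of k] by (simp add: u_def t_def)
    then obtain v s where v: "v \<in> sphere 0 1" and s: "strict_mono s" and lim: "(u \<circ> s) \<longlonglongrightarrow> v"
      using compact_sphere[of "0::'c" 1] unfolding compact_def by metis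
    have a_eq: "a (r k) = t k *\<^sub>R u k" for k
      using t_pos[of k] by (simp add: u_def)
    \<comment> \<open>Comparison with the competitor 0, where both functionals vanish by
      homogeneity, gives t^2 Qn(u) <= 2 t Pn(u). As t tends to infinity this forces Q <= 0 at the
      limit of the directions u.\<close>
    have le: "Qn (r k) (u k) \<le> 2 * Pn (r k) (u k) * inverse (t k)" for k
    proof -
      have "Qn n 0 = 0" "Pn n 0 = 0" for n
        using Q_hom[of 0 n 0] P_hom[of 0 n 0] by auto
      then have "Qn (r k) (a (r k)) \<le> 2 * Pn (r k) (a (r k))"
        using min[of "r k" 0] r(1)[of k] by simp
      then have "t k * (t k * Qn (r k) (u k)) \<le> t k * (2 * Pn (r k) (u k))"
        unfolding a_eq using t_pos[of k] by (simp add: Q_hom P_hom power2_eq_square mult_ac)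
      then show ?thesis
        using t_pos[of k] by (simp add: field_simps)
    qed
    have r_top: "filterlim (\<lambda>k. r (s k)) at_top sequentially"
      by (rule to_top[OF r(1) s])
    have "filterlim (\<lambda>k. t (s k)) at_top sequentially"
    proof (rule filterlim_at_top_mono[OF filterlim_real_sequentially])
      have "real k \<le> t (s k)" for k
        using t[of "s k"] seq_suble[OF s, of k] by simp
      then show "\<forall>\<^sub>F k in sequentially. real k \<le> t (s k)" by simp
    qed
    then have "(\<lambda>k. inverse (t (s k))) \<longlonglongrightarrow> 0"
      by (rule tendsto_inverse_0_at_top)
    then have "(\<lambda>k. 2 * Pn (r (s k)) ((u \<circ> s) k) * inverse (t (s k))) \<longlonglongrightarrow> 2 * P v * 0"
      by (intro tendsto_mult tendsto_const comp[OF P r_top lim])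
    then have "Q v \<le> 2 * P v * 0"
      by (rule LIMSEQ_le[OF comp[OF Q r_top lim]]) (use le in auto)
    with pos[of v] v show False by force
  qed
  \<comment> \<open>This is stated for every index sequence because it is used twice: with
    \<open>Suc\<close> it yields a minimizer, and along indices that stay at distance e from
    \<open>S\<close> it yields a contradiction.\<close>
  have sub: "\<exists>s l. strict_mono s \<and> l \<in> S \<and> (\<lambda>k. a (r (s k))) \<longlonglongrightarrow> l"
    if r: "\<And>k. Suc k \<le> r k" for r
  proof -
    have "bounded (range (\<lambda>k. a (r k)))"
      using bdd by (auto simp: Bseq_eq_bounded intro: bounded_subset)
    then obtain l s where s: "strict_mono s" and lim: "((\<lambda>k. a (r k)) \<circ> s) \<longlonglongrightarrow> l"
      using bounded_imp_convergent_subsequence by metis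
    have r_top: "filterlim (\<lambda>k. r (s k)) at_top sequentially"
      by (rule to_top[OF r s])
    have "Q l - 2 * P l \<le> Q B - 2 * P B" for B
    proof (rule LIMSEQ_le)
      show "(\<lambda>k. Qn (r (s k)) (((\<lambda>k. a (r k)) \<circ> s) k) - 2 * Pn (r (s k)) (((\<lambda>k. a (r k)) \<circ> s) k))
          \<longlonglongrightarrow> Q l - 2 * P l"
        by (intro tendsto_intros comp[OF Q r_top lim] comp[OF P r_top lim])
      show "(\<lambda>k. Qn (r (s k)) B - 2 * Pn (r (s k)) B) \<longlonglongrightarrow> Q B - 2 * P B"
        by (intro tendsto_intros comp[OF Q r_top tendsto_const] comp[OF P r_top tendsto_const])
      show "\<exists>N. \<forall>k\<ge>N. Qn (r (s k)) (((\<lambda>k. a (r k)) \<circ> s) k) - 2 * Pn (r (s k)) (((\<lambda>k. a (r k)) \<circ> s) k)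
          \<le> Qn (r (s k)) B - 2 * Pn (r (s k)) B"
        using min r by (auto intro: order_trans[OF _ r])
    qed
    then show ?thesis using s lim unfolding S_def comp_def by blast
  qed
  show "S \<noteq> {}"
    using sub[of Suc] by auto
  show "(\<lambda>n. infdist (a n) S) \<longlonglongrightarrow> 0"
  proof (rule ccontr)
    assume "\<not> (\<lambda>n. infdist (a n) S) \<longlonglongrightarrow> 0"
    then obtain e where e: "0 < e" "\<exists>\<^sub>F n in sequentially. \<not> infdist (a n) S < e"
      by (auto simp: tendsto_iff frequently_def dist_real_def abs_of_nonneg infdist_nonneg)
    then obtain r where r: "\<And>k. Suc k \<le> r k" "\<And>k. \<not> infdist (a (r k)) S < e"
      using inf_many[of "\<lambda>_ n. \<not> infdist (a n) S < e"] by auto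
    obtain s l where l: "l \<in> S" "(\<lambda>k. a (r (s k))) \<longlonglongrightarrow> l"
      using sub[OF r(1)] by auto
    obtain k where "dist (a (r (s k))) l < e"
      using tendstoD[OF l(2) e(1)] eventually_happens' by fastforce
    then show False
      using r(2)[of "s k"] infdist_le[OF l(1), of "a (r (s k))"] by linarith
  qed
qed

subsection \<open>Support functions, matrices and orbits\<close>

lemma abs_SUP_diff_le:
  fixes f g :: "'a \<Rightarrow> real"
  assumes "S \<noteq> {}" "bdd_above (f ` S)" "bdd_above (g ` S)" "\<And>x. x \<in> S \<Longrightarrow> \<bar>f x - g x\<bar> \<le> c"
  shows "\<bar>(SUP x\<in>S. f x) - (SUP x\<in>S. g x)\<bar> \<le> c"
proof -
  have "(SUP x\<in>S. f x) \<le> (SUP x\<in>S. g x) + c"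
  proof (rule cSUP_least[OF assms(1)])
    fix x assume "x \<in> S"
    then show "f x \<le> (SUP x\<in>S. g x) + c"
      using assms(4) cSUP_upper[OF _ assms(3)] by fastforce
  qed
  moreover have "(SUP x\<in>S. g x) \<le> (SUP x\<in>S. f x) + c"
  proof (rule cSUP_least[OF assms(1)])
    fix x assume "x \<in> S"
    then show "g x \<le> (SUP x\<in>S. f x) + c"
      using assms(4) cSUP_upper[OF _ assms(2)] by fastforce
  qed
  ultimately show ?thesis by linarith
qed

text \<open>Cauchy-Schwarz in each row suffices, since the Frobenius norm is the Euclidean norm of
  the vector of row norms.\<close>

lemma norm_matrix_vector_mult_le:
  fixes A :: "real^'n^'m"
  shows "norm (A *v x) \<le> norm A * norm x"
proof -
  have "norm (A *v x) \<le> L2_set (\<lambda>i. norm (A $ i) * norm x) UNIV"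
    unfolding norm_vec_def[of "A *v x"]
    by (rule L2_set_mono) (auto simp: matrix_vector_mul_component Cauchy_Schwarz_ineq2)
  also have "\<dots> = norm A * norm x"
    by (simp add: norm_vec_def[of A] L2_set_left_distrib)
  finally show ?thesis .
qed

text \<open>Row i of \<open>A ** Q\<close> is the transpose of Q applied to row i of A, so every row
  norm is preserved.\<close>

lemma norm_matrix_mult_orthogonal:
  fixes A :: "real^'n^'m" and Q :: "real^'n^'n"
  assumes "orthogonal_matrix Q"
  shows "norm (A ** Q) = norm A"
proof -
  have "orthogonal_transformation ((*v) (transpose Q))"
    using assms by (simp add: orthogonal_transformation_matrix orthogonal_matrix_transpose)
  then have "norm (transpose Q *v v) = norm v" for v
    by (simp add: orthogonal_transformation)
  moreover have "(A ** Q) $ i = transpose Q *v (A $ i)" for i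
    by (simp add: vec_eq_iff matrix_matrix_mult_def matrix_vector_mult_def transpose_def mult.commute)
  ultimately show ?thesis
    by (simp add: norm_vec_def[of "A ** Q"] norm_vec_def[of A])
qed

section \<open>Regularity and homogeneity of support functions\<close>

lemma bdd_above_inner_image:
  fixes K :: "'a::real_inner set"
  assumes "bounded K"
  shows "bdd_above ((\<lambda>x. x \<bullet> u) ` K)"
proof -
  obtain R where "\<And>x. x \<in> K \<Longrightarrow> norm x \<le> R"
    using assms by (auto simp: bounded_iff)
  then have "x \<bullet> u \<le> R * norm u" if "x \<in> K" for x
    using that norm_cauchy_schwarz[of x u] by (meson mult_right_mono norm_ge_zero order_trans)
  then show ?thesis by (rule bdd_aboveI2)
qed

lemma support_fun_lipschitz:
  assumes "K \<noteq> {}" "\<And>x. x \<in> K \<Longrightarrow> norm x \<le> R"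
  shows "\<bar>support_fun K u - support_fun K v\<bar> \<le> R * norm (u - v)"
  unfolding support_fun_def
proof (rule abs_SUP_diff_le)
  have "bounded K" using assms(2) by (auto simp: bounded_iff)
  then show "bdd_above ((\<lambda>x. x \<bullet> u) ` K)" "bdd_above ((\<lambda>x. x \<bullet> v) ` K)"
    by (rule bdd_above_inner_image)+
  fix x assume "x \<in> K"
  then show "\<bar>x \<bullet> u - x \<bullet> v\<bar> \<le> R * norm (u - v)"
    using Cauchy_Schwarz_ineq2[of x "u - v"] assms(2)[of x]
    by (simp add: inner_diff_right) (meson mult_right_mono norm_ge_zero order_trans)
qed (rule assms)

lemma support_fun_0: "K \<noteq> {} \<Longrightarrow> support_fun K 0 = 0"
  by (simp add: support_fun_def)

lemma continuous_on_support_fun: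
  assumes "K \<noteq> {}" "bounded K"
  shows "continuous_on S (support_fun K)"
proof -
  obtain R where R: "0 < R" "\<And>x. x \<in> K \<Longrightarrow> norm x \<le> R"
    using assms(2) by (auto simp: bounded_pos)
  have "continuous_on UNIV (support_fun K)"
  proof (rule lipschitz_on_continuous_on)
    show "R-lipschitz_on UNIV (support_fun K)"
      using support_fun_lipschitz[OF assms(1) R(2)] R(1)
      by (intro lipschitz_onI) (auto simp: dist_norm)
  qed
  then show ?thesis by (rule continuous_on_subset) simp
qed

lemma support_fun_sphere_bounded:
  fixes K :: "(real^'d) set"
  assumes K: "K \<noteq> {}" "bounded K"
  shows "\<exists>b. \<forall>u\<in>sphere 0 1. \<bar>support_fun K u\<bar> \<le> b"
proof -
  obtain R where R: "\<And>x. x \<in> K \<Longrightarrow> norm x \<le> R"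
    using K(2) by (auto simp: bounded_iff)
  show ?thesis
  proof (intro exI ballI)
    fix u :: "real^'d" assume "u \<in> sphere 0 1"
    then show "\<bar>support_fun K u\<bar> \<le> R"
      using support_fun_lipschitz[OF K(1) R, of u 0] by (simp add: support_fun_0 K(1))
  qed
qed

lemma support_fun_measurable:
  "K \<noteq> {} \<Longrightarrow> bounded K \<Longrightarrow> support_fun K \<in> borel_measurable borel"
  by (intro borel_measurable_continuous_onI continuous_on_support_fun)

lemma support_fun_scaleR:
  assumes "K \<noteq> {}" "bounded K" "0 \<le> t"
  shows "support_fun K (t *\<^sub>R u) = t * support_fun K u"
proof -
  \<comment> \<open>Only one inequality is proved directly; the reverse one is the same inequality
    at the vector t u with factor 1 / t.\<close>
  have le: "support_fun K (s *\<^sub>R v) \<le> s * support_fun K v" if "0 \<le> s" for s v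
    unfolding support_fun_def using assms(1) that cSUP_upper[OF _ bdd_above_inner_image[OF assms(2)], of _ v]
    by (intro cSUP_least) (auto intro: mult_left_mono)
  show ?thesis
  proof (cases "t = 0")
    case False
    then have "t * support_fun K u \<le> support_fun K (t *\<^sub>R u)"
      using le[of "1 / t" "t *\<^sub>R u"] assms(3) by (simp add: field_simps)
    with le[of t u] assms(3) show ?thesis by simp
  qed (simp add: support_fun_0 assms)
qed

lemma support_fun_linear_image:
  fixes A :: "real^'q^'d"
  shows "support_fun ((*v) A ` C) u = support_fun C (transpose A *v u)"
proof -
  have "(A *v x) \<bullet> u = x \<bullet> (transpose A *v u)" for x
    by (metis dot_lmul_matrix inner_commute transpose_matrix_vector)
  then show ?thesis by (simp add: support_fun_def image_image)
qed

text \<open>As a supremum of the products of A x with u over x in C, the value depends on A only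
  through quantities that change by at most norm (A - B) norm x. Both the uniform law and the final
  bound on \<open>rho\<close> rest on this estimate.\<close>

lemma support_fun_matrix_lipschitz:
  fixes A B :: "real^'q^'d"
  assumes "C \<noteq> {}" "\<And>x. x \<in> C \<Longrightarrow> norm x \<le> R" "norm u = 1"
  shows "\<bar>support_fun C (transpose A *v u) - support_fun C (transpose B *v u)\<bar> \<le> R * norm (A - B)"
proof -
  have eq: "support_fun C (transpose D *v u) = (SUP x\<in>C. (D *v x) \<bullet> u)" for D :: "real^'q^'d"
    using support_fun_linear_image[of D C u, symmetric] by (simp only: support_fun_def image_image)
  have "bounded C" using assms(2) by (auto simp: bounded_iff)
  then have "bounded ((*v) D ` C)" for D :: "real^'q^'d"
    by (rule bounded_linear_image) simp
  from bdd_above_inner_image[OF this]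
  have bdd: "bdd_above ((\<lambda>x. (D *v x) \<bullet> u) ` C)" for D :: "real^'q^'d"
    by (simp add: image_image)
  have le: "\<bar>(A *v x) \<bullet> u - (B *v x) \<bullet> u\<bar> \<le> R * norm (A - B)" if "x \<in> C" for x
  proof -
    have "\<bar>(A *v x) \<bullet> u - (B *v x) \<bullet> u\<bar> = \<bar>((A - B) *v x) \<bullet> u\<bar>"
      by (simp add: inner_diff_left matrix_vector_mult_diff_rdistrib)
    also have "\<dots> \<le> norm ((A - B) *v x)"
      using Cauchy_Schwarz_ineq2[of "(A - B) *v x" u] assms(3) by simp
    also have "\<dots> \<le> norm (A - B) * norm x"
      by (rule norm_matrix_vector_mult_le)
    also have "\<dots> \<le> norm (A - B) * R"
      using assms(2) \<open>x \<in> C\<close> by (intro mult_left_mono) auto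
    finally show ?thesis
      by (simp add: mult.commute)
  qed
  show ?thesis
    unfolding eq by (intro abs_SUP_diff_le assms(1) bdd le)
qed

lemma continuous_on_support_fun_matrix:
  fixes A :: "real^'q^'d"
  assumes "C \<noteq> {}" "bounded C"
  shows "continuous_on S (\<lambda>u. support_fun C (transpose A *v u))"
proof -
  have "bounded ((*v) A ` C)"
    using assms(2) by (rule bounded_linear_image) simp
  then show ?thesis
    unfolding support_fun_linear_image[symmetric]
    using assms(1) by (intro continuous_on_support_fun) auto
qed

lemma support_fun_matrix_measurable:
  fixes A :: "real^'q^'d"
  assumes "C \<noteq> {}" "bounded C"
  shows "(\<lambda>u. support_fun C (transpose A *v u)) \<in> borel_measurable borel"
  by (intro borel_measurable_continuous_onI continuous_on_support_fun_matrix assms)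

text \<open>The Lipschitz estimate is compared with the zero matrix, where the support function
  vanishes.\<close>

lemma support_fun_matrix_bound:
  fixes A :: "real^'q^'d"
  assumes "C \<noteq> {}" "\<And>x. x \<in> C \<Longrightarrow> norm x \<le> R" "norm u = 1"
  shows "\<bar>support_fun C (transpose A *v u)\<bar> \<le> R * norm A"
proof -
  have "transpose (0 :: real^'q^'d) = 0"
    by (simp add: transpose_def vec_eq_iff)
  with support_fun_matrix_lipschitz[OF assms, of A 0] show ?thesis
    by (simp only: matrix_vector_mult_0 support_fun_0[OF assms(1)] diff_zero)
qed

text \<open>If \<open>C\<close> lay in the hyperplane \<open>v\<^sup>\<bottom>\<close>, then \<open>x \<mapsto> x + (v \<bullet> x) v\<close> would be a non-orthogonal
  element of \<open>Aut C\<close>.\<close>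

lemma Aut_orthogonal_imp_spanning:
  fixes C :: "(real^'q) set"
  assumes orth: "\<And>g. g \<in> Aut C \<Longrightarrow> orthogonal_matrix g" and "v \<noteq> 0"
  shows "\<exists>x\<in>C. x \<bullet> v \<noteq> 0"
proof (rule ccontr)
  assume "\<not> ?thesis"
  then have perp: "v \<bullet> x = 0" if "x \<in> C" for x
    using that by (auto simp: inner_commute)
  define g :: "real^'q^'q" where "g = matrix (\<lambda>x. x + (v \<bullet> x) *\<^sub>R v)"
  have "linear (\<lambda>x. x + (v \<bullet> x) *\<^sub>R v)"
    by (rule linearI) (auto simp: algebra_simps inner_add_right)
  then have g: "g *v x = x + (v \<bullet> x) *\<^sub>R v" for x
    unfolding g_def by (simp add: matrix_works linear_matrix_vector_mul_eq)
  have "(*v) g ` C = C"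
    using perp by (auto simp: g image_iff)
  then have "orthogonal_transformation ((*v) g)"
    using orth by (simp add: Aut_def orthogonal_transformation_matrix)
  then have "norm (v + (v \<bullet> v) *\<^sub>R v) = norm v"
    unfolding g[symmetric] by (simp add: orthogonal_transformation)
  \<comment> \<open>So v is an eigenvector of g with eigenvalue 1 + norm v ^ 2 > 1, which
    contradicts preservation of the norm.\<close>
  moreover have "v + (v \<bullet> v) *\<^sub>R v = (1 + v \<bullet> v) *\<^sub>R v"
    by (simp add: algebra_simps)
  ultimately have "\<bar>1 + v \<bullet> v\<bar> * norm v = norm v" by simp
  with \<open>v \<noteq> 0\<close> inner_gt_zero_iff[of v] show False by simp
qed

text \<open>Some x in C has a nonzero inner product with a nonzero vector in the range of the
  transpose of A. Passing from u to -u if necessary makes this product positive, hence also the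
  supremum, and positive homogeneity moves the point to the sphere.\<close>

lemma support_fun_matrix_nonzero:
  fixes A :: "real^'q^'d"
  assumes "C \<noteq> {}" "bounded C" and span: "\<And>v. v \<noteq> 0 \<Longrightarrow> \<exists>x\<in>C. x \<bullet> v \<noteq> 0" and "A \<noteq> 0"
  shows "\<exists>u\<in>sphere 0 1. support_fun C (transpose A *v u) \<noteq> 0"
proof -
  have "transpose A \<noteq> 0"
    using \<open>A \<noteq> 0\<close> by (simp add: transpose_def vec_eq_iff) blast
  then obtain u where u: "transpose A *v u \<noteq> 0"
    using matrix_eq[of "transpose A" 0] by auto
  then obtain x where x: "x \<in> C" "x \<bullet> (transpose A *v u) \<noteq> 0"
    using span by blast
  have "\<exists>w. support_fun C (transpose A *v w) > 0"
  proof (cases "x \<bullet> (transpose A *v u) > 0")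
    case True
    then have "0 < support_fun C (transpose A *v u)"
      unfolding support_fun_def
      by (rule less_le_trans[OF _ cSUP_upper[OF x(1) bdd_above_inner_image[OF assms(2)]]])
    then show ?thesis by blast
  next
    case False
    have "transpose A *v (- u) = - (transpose A *v u)"
      using matrix_vector_mult_scaleR[of "transpose A" "- 1" u] by simp
    then have "0 < x \<bullet> (transpose A *v (- u))"
      using False x(2) by simp
    then have "0 < support_fun C (transpose A *v (- u))"
      unfolding support_fun_def
      by (rule less_le_trans[OF _ cSUP_upper[OF x(1) bdd_above_inner_image[OF assms(2)]]])
    then show ?thesis by blast
  qed
  then obtain w where w: "support_fun C (transpose A *v w) > 0" by blast
  then have "w \<noteq> 0"
    by (auto simp: support_fun_0 assms(1))
  moreover have "transpose A *v sgn w = inverse (norm w) *\<^sub>R (transpose A *v w)"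
    by (simp add: sgn_div_norm matrix_vector_mult_scaleR)
  then have "support_fun C (transpose A *v sgn w) = inverse (norm w) * support_fun C (transpose A *v w)"
    by (simp add: support_fun_scaleR assms)
  ultimately show ?thesis
    using w by (intro bexI[of _ "sgn w"]) (auto simp: norm_sgn)
qed

text \<open>The point A g is matched with B g for the same g; their distance is norm ((A - B) g) =
  norm (A - B), as g is orthogonal. The identity in \<open>Aut C\<close> makes the orbits nonempty,
  so the suprema are genuine.\<close>

lemma hausdorff_dist_orbit_le:
  fixes A B :: "real^'q^'d"
  assumes orth: "\<And>g. g \<in> Aut C \<Longrightarrow> orthogonal_matrix g"
  shows "0 \<le> hausdorff_dist (orbit_Aut C A) (orbit_Aut C B)"
    and "hausdorff_dist (orbit_Aut C A) (orbit_Aut C B) \<le> dist A B"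
proof -
  have one: "mat 1 \<in> Aut C" by (simp add: Aut_def)
  then have ne: "orbit_Aut C D \<noteq> {}" for D :: "real^'q^'d"
    by (auto simp: orbit_Aut_def)
  have le: "infdist s (orbit_Aut C B) \<le> dist A B" if s: "s \<in> orbit_Aut C A" for s and A B :: "real^'q^'d"
  proof -
    obtain g where g: "g \<in> Aut C" "s = A ** g" using s by (auto simp: orbit_Aut_def)
    have "infdist s (orbit_Aut C B) \<le> dist (A ** g) (B ** g)"
      unfolding g(2) using g(1) by (intro infdist_le) (auto simp: orbit_Aut_def)
    also have "\<dots> = norm ((A - B) ** g)"
      by (simp add: dist_norm matrix_matrix_mult_def minus_vec_def sum_subtractf left_diff_distrib)
    also have "\<dots> = dist A B"
      by (simp add: dist_norm norm_matrix_mult_orthogonal orth g(1))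
    finally show ?thesis .
  qed
  have "(SUP s\<in>orbit_Aut C A. infdist s (orbit_Aut C B)) \<le> dist A B"
    by (rule cSUP_least[OF ne le])
  moreover have "(SUP s\<in>orbit_Aut C B. infdist s (orbit_Aut C A)) \<le> dist A B"
    by (rule cSUP_least[OF ne]) (metis le dist_commute)
  ultimately show "hausdorff_dist (orbit_Aut C A) (orbit_Aut C B) \<le> dist A B"
    by (simp add: hausdorff_dist_def)
  obtain s where s: "s \<in> orbit_Aut C A" using ne by blast
  have "0 \<le> (SUP s\<in>orbit_Aut C A. infdist s (orbit_Aut C B))"
    using le by (intro cSUP_upper2[OF _ s infdist_nonneg] bdd_aboveI2) auto
  then show "0 \<le> hausdorff_dist (orbit_Aut C A) (orbit_Aut C B)"
    by (simp add: hausdorff_dist_def)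
qed

subsection \<open>The uniform distribution on the sphere\<close>

lemma space_sphere_measure [simp]: "space sphere_measure = sphere 0 1"
  by (simp add: sphere_measure_def space_scale_measure space_restrict_space)

lemma sets_sphere_measure [simp, measurable_cong]:
  "sets sphere_measure = sets (restrict_space borel (sphere 0 1))"
  by (simp add: sphere_measure_def)

lemma measurable_sgn_sphere:
  "(sgn :: real^'d \<Rightarrow> real^'d) \<in>
    measurable (restrict_space lborel (cball 0 1 - {0})) (restrict_space borel (sphere 0 1))"
proof (rule measurable_restrict_space2)
  show "sgn \<in> borel_measurable (restrict_space lborel (cball 0 1 - {0 :: real^'d}))"
    unfolding sgn_div_norm by (intro measurable_restrict_space1) measurable
qed (auto simp: space_restrict_space norm_sgn)

lemma emeasure_sphere_measure:
  fixes E :: "(real^'d) set"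
  assumes "E \<in> sets (restrict_space borel (sphere 0 1))"
  shows "emeasure sphere_measure E =
    of_nat CARD('d) * emeasure lborel {x \<in> cball 0 1 - {0}. sgn x \<in> E}"
proof -
  have "sgn -` E \<inter> space (restrict_space lborel (cball 0 1 - {0})) = {x \<in> cball 0 1 - {0}. sgn x \<in> E}"
    by (auto simp: space_restrict_space)
  then show ?thesis
    using assms emeasure_restrict_space[of "cball 0 1 - {0}" lborel "{x \<in> cball 0 1 - {0}. sgn x \<in> E}"]
    unfolding sphere_measure_def
    by (simp add: emeasure_distr[OF measurable_sgn_sphere] subset_iff)
qed

text \<open>The part of the cone over V in the punctured open unit ball is open and contains u / 2,
  and a nonempty open set is not negligible. The open ball keeps the set open, and leaving out the
  origin keeps \<open>sgn\<close> continuous.\<close>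

lemma emeasure_sphere_measure_open_pos:
  fixes V :: "(real^'d) set"
  assumes "open V" "u \<in> V" "u \<in> sphere 0 1"
  shows "emeasure sphere_measure (V \<inter> sphere 0 1) \<noteq> 0"
proof
  let ?W = "{x \<in> ball 0 1 - {0}. sgn x \<in> V}"
  have E: "V \<inter> sphere 0 1 \<in> sets (restrict_space borel (sphere (0 :: real^'d) 1))"
    using assms(1) by (simp add: sets_restrict_space_iff)
  assume "emeasure sphere_measure (V \<inter> sphere 0 1) = 0"
  then have zero: "emeasure lborel {x \<in> cball 0 1 - {0}. sgn x \<in> V \<inter> sphere 0 1} = 0"
    by (simp add: emeasure_sphere_measure[OF E])
  have "continuous_on (ball 0 1 - {0}) (sgn :: real^'d \<Rightarrow> real^'d)"
    by (intro continuous_intros) auto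
  then have "open ((ball 0 1 - {0}) \<inter> sgn -` V)"
    using assms(1) by (intro continuous_open_preimage) auto
  moreover have "(ball 0 1 - {0}) \<inter> sgn -` V = ?W" by auto
  ultimately have W: "open ?W" by simp
  have "{x \<in> cball 0 1 - {0}. sgn x \<in> V \<inter> sphere 0 1} \<in> sets lborel"
  proof -
    have "{x \<in> cball 0 1 - {0}. sgn x \<in> V \<inter> sphere 0 1}
        = sgn -` (V \<inter> sphere 0 1) \<inter> space (restrict_space lborel (cball 0 1 - {0}))"
      by (auto simp: space_restrict_space)
    also have "\<dots> \<in> sets (restrict_space lborel (cball 0 1 - {0}))"
      by (rule measurable_sets[OF measurable_sgn_sphere E])
    finally show ?thesis
      by (subst (asm) sets_restrict_space_iff) auto
  qed
  then have "emeasure lborel ?W \<le> emeasure lborel {x \<in> cball 0 1 - {0}. sgn x \<in> V \<inter> sphere 0 1}"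
    by (intro emeasure_mono) (auto simp: norm_sgn)
  then have "?W \<in> null_sets lborel"
    using zero W by auto
  then have "negligible ?W"
    using W by (simp add: negligible_iff_null_sets null_sets_completionI)
  moreover have "(1/2) *\<^sub>R u \<in> ?W"
    using assms(2,3) by (auto simp: sgn_div_norm)
  ultimately show False
    using W open_not_negligible by blast
qed

lemma finite_sphere_measure: "emeasure (sphere_measure :: (real^'d) measure) (sphere 0 1) \<noteq> \<infinity>"
proof -
  have "emeasure lborel {x \<in> cball (0 :: real^'d) 1 - {0}. sgn x \<in> sphere 0 1} \<le> emeasure lborel (cball (0 :: real^'d) 1)"
    by (intro emeasure_mono) auto
  also have "\<dots> < \<infinity>"
    by (rule emeasure_lborel_cball_finite)
  finally show ?thesis
    by (subst emeasure_sphere_measure) (auto simp: sets_restrict_space ennreal_mult_eq_top_iff)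
qed

lemma sphere_nonempty: "sphere (0 :: real^'d) 1 \<noteq> {}"
  by (simp add: sphere_eq_empty)

lemma space_uniform_sphere [simp]: "space uniform_sphere = sphere 0 1"
  by (simp add: uniform_sphere_def)

lemma sets_uniform_sphere [simp, measurable_cong]:
  "sets uniform_sphere = sets (restrict_space borel (sphere 0 1))"
  by (simp add: uniform_sphere_def)

lemma emeasure_sphere_measure_nonzero: "emeasure (sphere_measure :: (real^'d) measure) (sphere 0 1) \<noteq> 0"
  using emeasure_sphere_measure_open_pos[of UNIV] sphere_nonempty by fastforce

lemma prob_space_uniform_sphere: "prob_space uniform_sphere"
  unfolding uniform_sphere_def
  by (intro prob_space_uniform_measure emeasure_sphere_measure_nonzero finite_sphere_measure)

text \<open>The set where g is nonzero is open; if it met the sphere, its trace would have positive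
  surface measure.\<close>

lemma AE_uniform_sphere_continuous:
  fixes g :: "real^'d \<Rightarrow> real"
  assumes cont: "continuous_on UNIV g" and ae: "AE u in uniform_sphere. g u = 0" and u: "u \<in> sphere 0 1"
  shows "g u = 0"
proof (rule ccontr)
  assume gu: "g u \<noteq> 0"
  define V where "V = g -` (- {0})"
  have V: "open V"
    unfolding V_def using cont by (intro open_vimage) auto
  have E: "V \<inter> sphere 0 1 \<in> sets sphere_measure"
    using V by (simp add: sets_restrict_space_iff)
  have "emeasure uniform_sphere (V \<inter> sphere 0 1) = 0"
    using ae E by (subst (asm) AE_iff_measurable[of "V \<inter> sphere 0 1"]) (auto simp: V_def)
  then have "emeasure sphere_measure (V \<inter> sphere 0 1) = 0"
    using E finite_sphere_measure emeasure_sphere_measure_nonzero unfolding uniform_sphere_def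
    by (subst (asm) emeasure_uniform_measure) (auto simp: sets_restrict_space ennreal_divide_eq_0_iff Int_ac)
  with emeasure_sphere_measure_open_pos[OF V _ u] gu show False
    by (auto simp: V_def)
qed

text \<open>A uniform bound c integrates to c times the total mass to the power 1 / p, and the
  maximum with 1 also covers p = infinity. Thus for each p the bound is a fixed multiple of
  c.\<close>

lemma rho_le:
  fixes K L :: "(real^'d) set"
  assumes p: "1 \<le> p" and c: "0 \<le> c"
    and le: "\<And>u. u \<in> sphere 0 1 \<Longrightarrow> \<bar>support_fun K u - support_fun L u\<bar> \<le> c"
  shows "0 \<le> rho p K L"
    and "rho p K L \<le> c * max 1 (measure (sphere_measure :: (real^'d) measure) (sphere 0 1) powr (1 / real_of_ereal p))"
proof -
  let ?\<mu> = "sphere_measure :: (real^'d) measure"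
  let ?f = "\<lambda>u. \<bar>support_fun K u - support_fun L u\<bar>"
  obtain u :: "real^'d" where u: "u \<in> sphere 0 1" using sphere_nonempty by blast
  have "0 \<le> rho p K L \<and> rho p K L \<le> c * max 1 (measure ?\<mu> (sphere 0 1) powr (1 / real_of_ereal p))"
  proof (cases "p = \<infinity>")
    case True
    have "0 \<le> (SUP u\<in>sphere 0 1. ?f u)"
      using le by (intro cSUP_upper2[OF _ u] bdd_aboveI2) auto
    moreover have "(SUP u\<in>sphere 0 1. ?f u) \<le> c"
      using sphere_nonempty le by (rule cSUP_least)
    moreover have "c \<le> c * max 1 r" for r
      using c mult_left_mono[of 1 "max 1 r" c] by simp
    ultimately show ?thesis
      using True by (auto simp: rho_def intro: order_trans)
  next
    case False
    then obtain r where r: "p = ereal r" "1 \<le> r"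
      using p by (cases p) auto
    have fin: "finite_measure ?\<mu>"
      by (rule finite_measureI) (use finite_sphere_measure in auto)
    have "(LINT u|?\<mu>. ?f u powr r) \<le> (LINT u|?\<mu>. c powr r)"
      \<comment> \<open>\<open>integral_mono'\<close> asks only the dominating constant to be
        integrable, so no measurability of \<open>support_fun L\<close> enters.\<close>
      using le r(2) by (intro integral_mono' finite_measure.integrable_const[OF fin] powr_mono2) auto
    then have "(LINT u|?\<mu>. ?f u powr r) powr (1 / r) \<le> (c powr r * measure ?\<mu> (sphere 0 1)) powr (1 / r)"
      using r(2) by (intro powr_mono2 integral_nonneg_AE) (auto simp: mult.commute)
    also have "\<dots> = c * measure ?\<mu> (sphere 0 1) powr (1 / r)"
      using c r(2) by (simp add: powr_mult powr_powr)
    also have "\<dots> \<le> c * max 1 (measure ?\<mu> (sphere 0 1) powr (1 / r))"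
      using c by (intro mult_left_mono) auto
    finally show ?thesis
      using False r(1) by (simp add: rho_def)
  qed
  then show "0 \<le> rho p K L"
    and "rho p K L \<le> c * max 1 (measure ?\<mu> (sphere 0 1) powr (1 / real_of_ereal p))" by auto
qed

subsection \<open>The observation law and its empirical version\<close>

lemma space_obs_space [simp]: "space obs_space = sphere 0 1 \<times> UNIV"
  by (simp add: obs_space_def space_pair_measure space_restrict_space)

lemma fst_obs_space: "fst \<in> measurable obs_space (restrict_space borel (sphere 0 1))"
  unfolding obs_space_def by (rule measurable_fst)

lemma snd_obs_space [measurable]: "snd \<in> borel_measurable obs_space"
  unfolding obs_space_def by (rule measurable_snd)

lemma support_fun_matrix_obs_measurable:
  fixes A :: "real^'q^'d"
  assumes "C \<noteq> {}" "bounded C"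
  shows "(\<lambda>z. support_fun C (transpose A *v fst z)) \<in> borel_measurable obs_space"
  by (rule measurable_compose[OF fst_obs_space measurable_restrict_space1[OF support_fun_matrix_measurable[OF assms]]])

text \<open>Expanding the square separates the loss into Q - 2 L and the second moment of y, which
  is constant in A. Allowing any finite measure covers the population law and every empirical
  measure, including that of the empty sample.\<close>

lemma minimizers_eq:
  fixes C :: "(real^'q) set" and P :: "((real^'d) \<times> real) measure"
  assumes C: "C \<noteq> {}" "bounded C" and P: "finite_measure P" "sets P = sets obs_space"
    and y: "integrable P (\<lambda>z. (snd z)\<^sup>2)"
  defines "Q \<equiv> \<lambda>A :: real^'q^'d. LINT z|P. (support_fun C (transpose A *v fst z))\<^sup>2"
    and "L \<equiv> \<lambda>A :: real^'q^'d. LINT z|P. support_fun C (transpose A *v fst z) * snd z"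
  shows "minimizers C P = {A. \<forall>B. Q A - 2 * L A \<le> Q B - 2 * L B}"
proof -
  obtain R where R: "0 < R" "\<And>x. x \<in> C \<Longrightarrow> norm x \<le> R"
    using C(2) by (auto simp: bounded_pos)
  have [measurable_cong]: "sets P = sets obs_space" by (rule P)
  have space: "space P = sphere 0 1 \<times> UNIV"
    using sets_eq_imp_space_eq[OF P(2)] by simp
  have eq: "loss C A P = Q A - 2 * L A + (LINT z|P. (snd z)\<^sup>2)" for A :: "real^'q^'d"
  proof -
    define f where "f z = support_fun C (transpose A *v fst z)" for z :: "(real^'d) \<times> real"
    have f[measurable]: "f \<in> borel_measurable obs_space"
      unfolding f_def by (rule support_fun_matrix_obs_measurable[OF C])
    have bound: "\<bar>f z\<bar> \<le> R * norm A" if "z \<in> space P" for z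
      unfolding f_def using that by (intro support_fun_matrix_bound C R) (auto simp: space)
    have i1: "integrable P (\<lambda>z. (f z)\<^sup>2)"
    proof (rule finite_measure.integrable_const_bound[OF P(1)])
      show "AE z in P. norm ((f z)\<^sup>2) \<le> (R * norm A)\<^sup>2"
        using bound power_mono[OF bound, of _ 2] by (intro AE_I2) simp
    qed measurable
    have i2: "integrable P (\<lambda>z. f z * snd z)"
    proof (rule Bochner_Integration.integrable_bound[OF Bochner_Integration.integrable_add[OF i1 y]])
      have "\<bar>a * b\<bar> \<le> a\<^sup>2 + b\<^sup>2" for a b :: real
        using sum_squares_bound[of "\<bar>a\<bar>" "\<bar>b\<bar>"] abs_ge_zero[of "a * b"] unfolding abs_mult power2_abs by linarith
      then show "AE z in P. norm (f z * snd z) \<le> norm ((f z)\<^sup>2 + (snd z)\<^sup>2)"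
        by (intro AE_I2) simp
    qed measurable
    have "loss C A P = (LINT z|P. (f z)\<^sup>2 - 2 * (f z * snd z) + (snd z)\<^sup>2)"
      unfolding loss_def f_def case_prod_beta power2_diff by (simp add: algebra_simps)
    also have "\<dots> = (LINT z|P. (f z)\<^sup>2) - 2 * (LINT z|P. f z * snd z) + (LINT z|P. (snd z)\<^sup>2)"
      using i1 i2 y by simp
    finally show ?thesis unfolding Q_def L_def f_def .
  qed
  show ?thesis
    unfolding minimizers_def is_arg_min_def eq by (auto simp: not_less)
qed

section \<open>Integration against the empirical measure\<close>

lemma integral_empirical_measure:
  fixes g :: "(real^'d) \<times> real \<Rightarrow> real"
  assumes "\<And>i. i < n \<Longrightarrow> x i \<in> space obs_space" "g \<in> borel_measurable obs_space"
  shows "integrable (empirical_measure n x) g"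
    and "integral\<^sup>L (empirical_measure n x) g = (\<Sum>i<n. g (x i)) / real n"
proof -
  have x: "x \<in> measurable (uniform_count_measure {..<n}) obs_space"
    unfolding uniform_count_measure_def using assms(1) by (auto simp: point_measure_def)
  show "integrable (empirical_measure n x) g"
    unfolding empirical_measure_def integrable_distr_eq[OF x assms(2)]
    unfolding uniform_count_measure_def by (rule integrable_point_measure_finite) simp
  show "integral\<^sup>L (empirical_measure n x) g = (\<Sum>i<n. g (x i)) / real n"
    unfolding empirical_measure_def integral_distr[OF x assms(2)]
    by (simp add: integral_uniform_count_measure)
qed

lemma finite_empirical_measure:
  assumes "\<And>i. i < n \<Longrightarrow> x i \<in> space obs_space"
  shows "finite_measure (empirical_measure n x)"
proof -
  have x: "x \<in> measurable (uniform_count_measure {..<n}) obs_space"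
    unfolding uniform_count_measure_def using assms by (auto simp: point_measure_def)
  have "finite_measure (uniform_count_measure {..<n})"
    by (intro finite_measureI) (simp add: emeasure_uniform_count_measure_if space_uniform_count_measure)
  then show ?thesis
    unfolding empirical_measure_def by (intro finite_measure.finite_measure_distr x)
qed

section \<open>Moments of the observation law and the population loss\<close>

lemma integrable_noise_sq:
  assumes \<nu>: "prob_space \<nu>" "sets \<nu> = sets borel" and noise2: "integrable \<nu> (\<lambda>e. e\<^sup>2)"
  shows "integrable ((uniform_sphere :: (real^'d) measure) \<Otimes>\<^sub>M \<nu>) (\<lambda>z. (snd z :: real)\<^sup>2)"
proof -
  interpret U: prob_space "uniform_sphere :: (real^'d) measure" by (rule prob_space_uniform_sphere)
  interpret N: prob_space \<nu> by (rule \<nu>)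
  interpret pair_sigma_finite \<nu> "uniform_sphere :: (real^'d) measure" ..
  have "integrable (distr (\<nu> \<Otimes>\<^sub>M (uniform_sphere :: (real^'d) measure)) \<nu> fst) (\<lambda>e. e\<^sup>2)"
    using noise2 by (simp add: U.distr_pair_fst)
  then have "integrable (\<nu> \<Otimes>\<^sub>M (uniform_sphere :: (real^'d) measure)) (\<lambda>z. (fst z)\<^sup>2)"
    using \<nu>(2) by (subst (asm) integrable_distr_eq) auto
  from integrable_product_swap[OF this] show ?thesis
    by (simp add: case_prod_beta')
qed

lemma integrable_residual_sq:
  fixes g :: "real^'d \<Rightarrow> real"
  assumes \<nu>: "prob_space \<nu>" "sets \<nu> = sets borel" and noise2: "integrable \<nu> (\<lambda>e. e\<^sup>2)"
    and g: "g \<in> borel_measurable borel" "\<And>u. u \<in> sphere 0 1 \<Longrightarrow> \<bar>g u\<bar> \<le> b"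
  shows "integrable ((uniform_sphere :: (real^'d) measure) \<Otimes>\<^sub>M \<nu>) (\<lambda>z. (g (fst z) + snd z)\<^sup>2)"
proof -
  interpret U: prob_space "uniform_sphere :: (real^'d) measure" by (rule prob_space_uniform_sphere)
  interpret N: prob_space \<nu> by (rule \<nu>)
  interpret pair_prob_space "uniform_sphere :: (real^'d) measure" \<nu> ..
  note [measurable_cong] = \<nu>(2)
  have [measurable]: "g \<in> borel_measurable (restrict_space borel (sphere 0 1))"
    by (intro measurable_restrict_space1 g)
  have "integrable ((uniform_sphere :: (real^'d) measure) \<Otimes>\<^sub>M \<nu>) (\<lambda>z. 2 * b\<^sup>2 + 2 * (snd z)\<^sup>2)"
    using integrable_noise_sq[OF \<nu> noise2]
    by (intro Bochner_Integration.integrable_add P.integrable_const integrable_mult_right)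
  then show ?thesis
  proof (rule Bochner_Integration.integrable_bound)
    show "AE z in (uniform_sphere :: (real^'d) measure) \<Otimes>\<^sub>M \<nu>. norm ((g (fst z) + snd z)\<^sup>2) \<le> norm (2 * b\<^sup>2 + 2 * (snd z)\<^sup>2)"
    proof (rule AE_I2)
      fix z assume "z \<in> space ((uniform_sphere :: (real^'d) measure) \<Otimes>\<^sub>M \<nu>)"
      then have "(g (fst z))\<^sup>2 \<le> b\<^sup>2"
        using power_mono[OF g(2), of "fst z" 2] by (auto simp: space_pair_measure)
      moreover have "(g (fst z) + snd z)\<^sup>2 \<le> 2 * (g (fst z))\<^sup>2 + 2 * (snd z)\<^sup>2"
        using sum_squares_bound[of "g (fst z)" "snd z"] by (simp add: power2_sum)
      ultimately show "norm ((g (fst z) + snd z)\<^sup>2) \<le> norm (2 * b\<^sup>2 + 2 * (snd z)\<^sup>2)"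
        by simp
    qed
  qed measurable
qed

context
  fixes K :: "(real^'d) set" and \<nu> :: "real measure"
  assumes K: "K \<noteq> {}" "bounded K" and \<nu>: "prob_space \<nu>" "sets \<nu> = sets borel"
begin

lemma measurable_obs_map:
  "(\<lambda>(u, e). (u, support_fun K u + e)) \<in> measurable (uniform_sphere \<Otimes>\<^sub>M \<nu>) obs_space"
proof -
  note [measurable_cong] = \<nu>(2)
  have [measurable]: "support_fun K \<in> borel_measurable (restrict_space borel (sphere 0 1))"
    by (intro measurable_restrict_space1 support_fun_measurable K)
  show ?thesis unfolding obs_space_def by measurable
qed

lemma prob_space_obs_law: "prob_space (obs_law K \<nu>)"
  unfolding obs_law_def
  by (rule prob_space.prob_space_distr[OF prob_space_pair[OF prob_space_uniform_sphere \<nu>(1)] measurable_obs_map])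

lemma distr_fst_obs_law: "distr (obs_law K \<nu>) (restrict_space borel (sphere 0 1)) fst = uniform_sphere"
proof -
  have "distr (obs_law K \<nu>) (restrict_space borel (sphere 0 1)) fst
      = distr (uniform_sphere \<Otimes>\<^sub>M \<nu>) (restrict_space borel (sphere 0 1)) fst"
    unfolding obs_law_def
    by (subst distr_distr[OF fst_obs_space measurable_obs_map]) (simp add: comp_def case_prod_beta)
  also have "\<dots> = distr (uniform_sphere \<Otimes>\<^sub>M \<nu>) uniform_sphere fst"
    by (rule distr_cong) simp_all
  also have "\<dots> = uniform_sphere"
    by (rule prob_space.distr_pair_fst[OF \<nu>(1)])
  finally show ?thesis .
qed

lemma integrable_obs_law_sq:
  assumes "integrable \<nu> (\<lambda>e. e\<^sup>2)"
  shows "integrable (obs_law K \<nu>) (\<lambda>z. (snd z)\<^sup>2)"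
proof -
  obtain b where "\<forall>u\<in>sphere 0 1. \<bar>support_fun K u\<bar> \<le> b"
    using support_fun_sphere_bounded[OF K] by blast
  then have "integrable ((uniform_sphere :: (real^'d) measure) \<Otimes>\<^sub>M \<nu>) (\<lambda>z. (support_fun K (fst z) + snd z)\<^sup>2)"
    using assms K \<nu> by (intro integrable_residual_sq[where b = b] support_fun_measurable) auto
  then show ?thesis
    unfolding obs_law_def
    by (subst integrable_distr_eq[OF measurable_obs_map]) (simp_all add: case_prod_beta)
qed

lemma loss_obs_law:
  fixes A :: "real^'q^'d"
  assumes noise: "integrable \<nu> (\<lambda>e. e)" "integrable \<nu> (\<lambda>e. e\<^sup>2)" "(LINT e|\<nu>. e) = 0"
    and C: "C \<noteq> {}" "bounded C"
  shows "loss C A (obs_law K \<nu>)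
    = (LINT u|uniform_sphere. (support_fun C (transpose A *v u) - support_fun K u)\<^sup>2) + (LINT e|\<nu>. e\<^sup>2)"
proof -
  interpret U: prob_space "uniform_sphere :: (real^'d) measure" by (rule prob_space_uniform_sphere)
  interpret N: prob_space \<nu> by (rule \<nu>)
  interpret pair_prob_space "uniform_sphere :: (real^'d) measure" \<nu> ..
  obtain R where R: "\<And>x. x \<in> C \<Longrightarrow> norm x \<le> R"
    using C(2) by (auto simp: bounded_iff)
  obtain b where b: "\<forall>u\<in>sphere 0 1. \<bar>support_fun K u\<bar> \<le> b"
    using support_fun_sphere_bounded[OF K] by blast
  define g where "g u = support_fun K u - support_fun C (transpose A *v u)" for u
  have g_meas: "g \<in> borel_measurable borel"
    unfolding g_def by (intro borel_measurable_diff support_fun_measurable support_fun_matrix_measurable K C)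
  then have [measurable]: "g \<in> borel_measurable (restrict_space borel (sphere 0 1))"
    by (intro measurable_restrict_space1)
  have g_bound: "\<bar>g u\<bar> \<le> b + R * norm A" if "u \<in> sphere 0 1" for u
    using b that support_fun_matrix_bound[OF C(1) R, of u A] unfolding g_def by fastforce
  have g2: "integrable uniform_sphere (\<lambda>u. (g u)\<^sup>2)"
  proof (rule U.integrable_const_bound)
    show "AE u in uniform_sphere. norm ((g u)\<^sup>2) \<le> (b + R * norm A)\<^sup>2"
      using power_mono[OF g_bound, of _ 2] by (intro AE_I2) auto
  qed measurable
  have f_meas: "(\<lambda>z. (support_fun C (transpose A *v fst z) - snd z)\<^sup>2) \<in> borel_measurable obs_space"
    by (intro borel_measurable_power borel_measurable_diff support_fun_matrix_obs_measurable C snd_obs_space)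
  have "loss C A (obs_law K \<nu>) = (LINT z|(uniform_sphere \<Otimes>\<^sub>M \<nu>). (g (fst z) + snd z)\<^sup>2)"
    unfolding loss_def obs_law_def case_prod_beta
    by (subst integral_distr[OF measurable_obs_map[unfolded case_prod_beta] f_meas])
      (simp add: g_def power2_commute algebra_simps)
  also have "\<dots> = (LINT u|uniform_sphere. LINT e|\<nu>. (g u + e)\<^sup>2)"
    using integral_fst'[OF integrable_residual_sq[OF \<nu> noise(2) g_meas g_bound]] by simp
  also have "\<dots> = (LINT u|uniform_sphere. (g u)\<^sup>2 + (LINT e|\<nu>. e\<^sup>2))"
    using noise by (simp add: power2_sum N.prob_space)
  also have "\<dots> = (LINT u|uniform_sphere. (g u)\<^sup>2) + (LINT e|\<nu>. e\<^sup>2)"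
    using g2 U.prob_space by simp
  finally show ?thesis
    by (simp add: g_def power2_commute)
qed

end

lemma le_mult_infdist:
  assumes "S \<noteq> {}" "0 < R" "\<And>a. a \<in> S \<Longrightarrow> t \<le> R * dist x a"
  shows "t \<le> R * infdist x S"
proof -
  have "t / R \<le> infdist x S"
    unfolding infdist_notempty[OF assms(1)]
    using assms by (intro cINF_greatest) (auto simp: field_simps)
  then show ?thesis using assms(2) by (simp add: field_simps)
qed

subsection \<open>Consistency of the regression\<close>

lemma consistency_minimizers:
  fixes Kstar :: "(real^'d) set"
    and C :: "(real^'q) set"
    and X :: "nat \<Rightarrow> 'w \<Rightarrow> (real^'d) \<times> real"
    and Ahat :: "nat \<Rightarrow> 'w \<Rightarrow> real^'q^'d"
  assumes K: "Kstar \<noteq> {}" "bounded Kstar" and C: "C \<noteq> {}" "bounded C"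
    and span: "\<And>v. v \<noteq> 0 \<Longrightarrow> \<exists>x\<in>C. x \<bullet> v \<noteq> 0"
    and \<nu>: "prob_space \<nu>" "sets \<nu> = sets borel" and noise2: "integrable \<nu> (\<lambda>e. e\<^sup>2)"
    and M: "prob_space M"
    and indep: "prob_space.indep_vars M (\<lambda>_. obs_space) X UNIV"
    and law: "\<And>i. distr M obs_space (X i) = obs_law Kstar \<nu>"
    and Ahat: "AE \<omega> in M. \<forall>n\<ge>1. Ahat n \<omega> \<in> minimizers C (empirical_measure n (\<lambda>i. X i \<omega>))"
  shows "minimizers C (obs_law Kstar \<nu>) \<noteq> ({} :: (real^'q^'d) set)"
    and "AE \<omega> in M. (\<lambda>n. infdist (Ahat n \<omega>) (minimizers C (obs_law Kstar \<nu>))) \<longlonglongrightarrow> 0"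
proof -
  interpret prob_space M by (rule M)
  let ?P = "obs_law Kstar \<nu>"
  interpret P: prob_space ?P by (rule prob_space_obs_law[OF K \<nu>])
  have sets_P[measurable_cong]: "sets ?P = sets obs_space"
    by (simp add: obs_law_def)
  have space_P: "space ?P = sphere 0 1 \<times> UNIV"
    using sets_eq_imp_space_eq[OF sets_P] by simp
  have rv: "X i \<in> measurable M obs_space" for i
    using indep by (auto simp: indep_vars_def)
  obtain R where R: "0 < R" "\<And>x. x \<in> C \<Longrightarrow> norm x \<le> R"
    using C(2) by (auto simp: bounded_pos)
  define f where "f A u = support_fun C (transpose A *v u)" for A :: "real^'q^'d" and u
  have f_meas[measurable]: "(\<lambda>z. f A (fst z)) \<in> borel_measurable obs_space" for A
    unfolding f_def by (rule support_fun_matrix_obs_measurable[OF C])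
  have f_lip: "\<bar>f A u - f B u\<bar> \<le> R * norm (A - B)" if "norm u = 1" for A B u
    unfolding f_def by (rule support_fun_matrix_lipschitz[OF C(1) R(2) that])
  have f_bound: "\<bar>f A u\<bar> \<le> R * norm A" if "norm u = 1" for A u
    unfolding f_def by (rule support_fun_matrix_bound[OF C(1) R(2) that])
  have f_hom: "f (t *\<^sub>R A) u = t * f A u" if "0 \<le> t" for t A u
  proof -
    have "transpose (t *\<^sub>R A) *v u = t *\<^sub>R (transpose A *v u)"
      by (simp add: vec_eq_iff matrix_vector_mult_def transpose_def sum_distrib_left mult_ac)
    then show ?thesis
      unfolding f_def by (simp only: support_fun_scaleR[OF C that])
  qed
  have y2: "integrable ?P (\<lambda>z. (snd z)\<^sup>2)"
    by (rule integrable_obs_law_sq[OF K \<nu> noise2])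
  define Q where "Q A = (LINT z|?P. (f A (fst z))\<^sup>2)" for A
  define L where "L A = (LINT z|?P. f A (fst z) * snd z)" for A
  have min_P: "minimizers C ?P = {A. \<forall>B. Q A - 2 * L A \<le> Q B - 2 * L B}"
    using minimizers_eq[OF C P.finite_measure sets_P y2] unfolding Q_def L_def f_def .
  have int_f4: "integrable ?P (\<lambda>z. ((f A (fst z))\<^sup>2)\<^sup>2)" for A
  proof (rule P.integrable_const_bound)
    have "(f A (fst z)) ^ 4 \<le> (R * norm A) ^ 4" if "z \<in> space ?P" for z
      using power_mono[OF f_bound[of "fst z" A], of 4] that by (auto simp: space_P)
    then show "AE z in ?P. norm (((f A (fst z))\<^sup>2)\<^sup>2) \<le> (R * norm A) ^ 4"
      by (intro AE_I2) simp
  qed measurable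
  have int_fy2: "integrable ?P (\<lambda>z. (f A (fst z) * snd z)\<^sup>2)" for A
  proof (rule Bochner_Integration.integrable_bound)
    show "integrable ?P (\<lambda>z. (R * norm A)\<^sup>2 * (snd z)\<^sup>2)"
      using y2 by simp
    have "(f A (fst z))\<^sup>2 \<le> (R * norm A)\<^sup>2" if "z \<in> space ?P" for z
      using power_mono[OF f_bound[of "fst z" A], of 2] that by (auto simp: space_P)
    then show "AE z in ?P. norm ((f A (fst z) * snd z)\<^sup>2) \<le> norm ((R * norm A)\<^sup>2 * (snd z)\<^sup>2)"
      by (intro AE_I2) (simp add: power_mult_distrib mult_right_mono)
  qed measurable
  have Q_pos: "0 < Q A" if "A \<noteq> 0" for A
  proof -
    have int_f2: "integrable ?P (\<lambda>z. (f A (fst z))\<^sup>2)"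
      by (rule P.square_integrable_imp_integrable[OF _ int_f4]) measurable
    have "Q A \<noteq> 0"
    proof
      assume "Q A = 0"
      then have "AE z in ?P. f A (fst z) = 0"
        using integral_nonneg_eq_0_iff_AE[OF int_f2] by (simp add: Q_def)
      moreover have "fst \<in> measurable ?P (restrict_space borel (sphere 0 1))"
        using fst_obs_space by (simp only: measurable_cong_sets[OF sets_P refl])
      moreover have [measurable]: "f A \<in> borel_measurable (restrict_space borel (sphere 0 1))"
        unfolding f_def by (rule measurable_restrict_space1[OF support_fun_matrix_measurable[OF C]])
      have "{u \<in> space (restrict_space borel (sphere 0 1)). f A u = 0} \<in> sets (restrict_space borel (sphere 0 1))"
        by measurable
      ultimately have "AE u in distr ?P (restrict_space borel (sphere 0 1)) fst. f A u = 0"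
        by (subst AE_distr_iff) auto
      then have "AE u in uniform_sphere. f A u = 0"
        by (simp only: distr_fst_obs_law[OF K \<nu>])
      moreover have "continuous_on UNIV (f A)"
        unfolding f_def by (rule continuous_on_support_fun_matrix[OF C])
      ultimately have "f A u = 0" if "u \<in> sphere 0 1" for u
        using AE_uniform_sphere_continuous that by blast
      then show False
        using support_fun_matrix_nonzero[OF C span \<open>A \<noteq> 0\<close>] unfolding f_def by blast
    qed
    moreover have "0 \<le> Q A" unfolding Q_def by simp
    ultimately show ?thesis by simp
  qed
  have "AE \<omega> in M. \<forall>A. ((\<lambda>(n, B). (\<Sum>i<n. (f B (fst (X i \<omega>)))\<^sup>2) / real n) \<longlongrightarrow> Q A) (sequentially \<times>\<^sub>F nhds A)"
    unfolding Q_def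
  proof (rule uniform_law_iid[OF indep law _ int_f4])
    show "(\<lambda>z. (f A (fst z))\<^sup>2) \<in> borel_measurable obs_space" for A
      by measurable
    show "(\<lambda>_. R\<^sup>2) \<in> borel_measurable obs_space" "integrable ?P (\<lambda>_. (R\<^sup>2)\<^sup>2)" "0 \<le> R\<^sup>2"
      by simp_all
    fix A B and z :: "(real^'d) \<times> real"
    assume "z \<in> space obs_space"
    then have u: "norm (fst z) = 1" by auto
    have "\<bar>(f A (fst z))\<^sup>2 - (f B (fst z))\<^sup>2\<bar> = \<bar>f A (fst z) - f B (fst z)\<bar> * \<bar>f A (fst z) + f B (fst z)\<bar>"
      by (simp add: abs_mult[symmetric] power2_eq_square algebra_simps)
    also have "\<dots> \<le> (R * norm (A - B)) * (R * (1 + norm A + norm B))"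
    proof (intro mult_mono f_lip u)
      have "\<bar>f A (fst z) + f B (fst z)\<bar> \<le> R * norm A + R * norm B"
        using f_bound[OF u, of A] f_bound[OF u, of B] by linarith
      then show "\<bar>f A (fst z) + f B (fst z)\<bar> \<le> R * (1 + norm A + norm B)"
        using R(1) by (simp add: algebra_simps)
    qed (use R(1) in auto)
    finally show "\<bar>(f A (fst z))\<^sup>2 - (f B (fst z))\<^sup>2\<bar> \<le> norm (A - B) * (1 + norm A + norm B) * R\<^sup>2"
      by (simp add: power2_eq_square mult_ac)
  qed
  moreover have "AE \<omega> in M. \<forall>A. ((\<lambda>(n, B). (\<Sum>i<n. f B (fst (X i \<omega>)) * snd (X i \<omega>)) / real n) \<longlongrightarrow> L A)
      (sequentially \<times>\<^sub>F nhds A)"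
    unfolding L_def
  proof (rule uniform_law_iid[OF indep law _ int_fy2])
    show "(\<lambda>z. f A (fst z) * snd z) \<in> borel_measurable obs_space" for A
      by measurable
    show "(\<lambda>z. R * \<bar>snd z\<bar>) \<in> borel_measurable obs_space"
      by measurable
    show "integrable ?P (\<lambda>z. (R * \<bar>snd z\<bar>)\<^sup>2)"
      using y2 by (simp add: power_mult_distrib)
    show "0 \<le> R * \<bar>snd z\<bar>" for z :: "(real^'d) \<times> real"
      using R(1) by simp
    fix A B and z :: "(real^'d) \<times> real"
    assume "z \<in> space obs_space"
    then have u: "norm (fst z) = 1" by auto
    have "\<bar>f A (fst z) * snd z - f B (fst z) * snd z\<bar> = \<bar>f A (fst z) - f B (fst z)\<bar> * 1 * \<bar>snd z\<bar>"
      by (simp add: abs_mult[symmetric] left_diff_distrib)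
    also have "\<dots> \<le> (R * norm (A - B)) * (1 + norm A + norm B) * \<bar>snd z\<bar>"
      using R(1) by (intro mult_mono f_lip u) auto
    finally show "\<bar>f A (fst z) * snd z - f B (fst z) * snd z\<bar>
        \<le> norm (A - B) * (1 + norm A + norm B) * (R * \<bar>snd z\<bar>)"
      by (simp add: mult_ac)
  qed
  ultimately have main: "AE \<omega> in M. minimizers C ?P \<noteq> ({} :: (real^'q^'d) set) \<and>
      (\<lambda>n. infdist (Ahat n \<omega>) (minimizers C ?P)) \<longlonglongrightarrow> 0"
    using Ahat AE_space
  proof eventually_elim
    case (elim \<omega>)
    define Qn where "Qn n A = (\<Sum>i<n. (f A (fst (X i \<omega>)))\<^sup>2) / real n" for n A
    define Pn where "Pn n A = (\<Sum>i<n. f A (fst (X i \<omega>)) * snd (X i \<omega>)) / real n" for n A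
    have X: "X i \<omega> \<in> space obs_space" for i
      using measurable_space[OF rv] elim(4) by blast
    have min_n: "minimizers C (empirical_measure n (\<lambda>i. X i \<omega>)) = {A. \<forall>B. Qn n A - 2 * Pn n A \<le> Qn n B - 2 * Pn n B}" for n
    proof -
      have *: "finite_measure (empirical_measure n (\<lambda>i. X i \<omega>))"
        "sets (empirical_measure n (\<lambda>i. X i \<omega>)) = sets obs_space"
        "integrable (empirical_measure n (\<lambda>i. X i \<omega>)) (\<lambda>z. (snd z)\<^sup>2)"
        by (rule finite_empirical_measure[OF X], simp add: empirical_measure_def,
            rule integral_empirical_measure(1)[OF X], measurable)
      have "(\<lambda>z. (f A (fst z))\<^sup>2) \<in> borel_measurable obs_space"
        "(\<lambda>z. f A (fst z) * snd z) \<in> borel_measurable obs_space" for A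
        by measurable
      then have "(LINT z|empirical_measure n (\<lambda>i. X i \<omega>). (f A (fst z))\<^sup>2) = Qn n A"
        "(LINT z|empirical_measure n (\<lambda>i. X i \<omega>). f A (fst z) * snd z) = Pn n A" for A
        unfolding Qn_def Pn_def by (simp_all only: integral_empirical_measure(2)[OF X])
      then show ?thesis
        using minimizers_eq[OF C *] unfolding f_def by simp
    qed
    have lims: "((\<lambda>(n, B). Qn n B) \<longlongrightarrow> Q A) (sequentially \<times>\<^sub>F nhds A)"
      "((\<lambda>(n, B). Pn n B) \<longlongrightarrow> L A) (sequentially \<times>\<^sub>F nhds A)" for A
      using elim(1,2) unfolding Qn_def Pn_def by blast+
    have hom: "Qn n (t *\<^sub>R A) = t\<^sup>2 * Qn n A" "Pn n (t *\<^sub>R A) = t * Pn n A" if "0 \<le> t" for n t A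
      unfolding Qn_def Pn_def
      by (simp_all add: f_hom[OF that] power_mult_distrib sum_distrib_left mult.assoc)
    have min: "Qn n (Ahat n \<omega>) - 2 * Pn n (Ahat n \<omega>) \<le> Qn n B - 2 * Pn n B" if "1 \<le> n" for n B
      using elim(3) that unfolding min_n by blast
    from argmin_consistent[OF lims hom Q_pos min]
    show ?case unfolding min_P by blast
  qed
  show "minimizers C ?P \<noteq> ({} :: (real^'q^'d) set)"
  proof -
    from main have "AE \<omega> in M. minimizers C ?P \<noteq> ({} :: (real^'q^'d) set)"
      by eventually_elim blast
    then show ?thesis by simp
  qed
  show "AE \<omega> in M. (\<lambda>n. infdist (Ahat n \<omega>) (minimizers C ?P)) \<longlonglongrightarrow> 0"
    using main by eventually_elim blast
qed

theorem theorem3p1: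
  fixes Kstar :: "(real^'d) set"
    and C :: "(real^'q) set"
    and \<nu> :: "real measure"
    and \<sigma> :: real
    and M :: "'w measure"
    and X :: "nat \<Rightarrow> 'w \<Rightarrow> (real^'d) \<times> real"
    and Ahat :: "nat \<Rightarrow> 'w \<Rightarrow> real^'q^'d"
  assumes Kstar: "compact Kstar" "convex Kstar" "Kstar \<noteq> {}"
    and C: "compact C" "convex C" "C \<noteq> {}"
    and Aut: "subgroup (Aut C) orthogonal_group_mat"
    and noise: "prob_space \<nu>" "sets \<nu> = sets borel"
      "integrable \<nu> (\<lambda>e. e)" "integrable \<nu> (\<lambda>e. e\<^sup>2)"
      "(LINT e|\<nu>. e) = 0" "(LINT e|\<nu>. e\<^sup>2) = \<sigma>\<^sup>2"
    and M: "prob_space M"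
    and indep: "prob_space.indep_vars M (\<lambda>_. obs_space) X UNIV"
    and law: "\<And>i. distr M obs_space (X i) = obs_law Kstar \<nu>"
    and Ahat: "AE \<omega> in M. \<forall>n\<ge>1. Ahat n \<omega> \<in> minimizers C (empirical_measure n (\<lambda>i. X i \<omega>))"
  shows "(AE \<omega> in M. (\<lambda>n. infdist (Ahat n \<omega>) (minimizers C (obs_law Kstar \<nu>))) \<longlonglongrightarrow> 0) \<and>
    (AE \<omega> in M. (\<lambda>n. INF A\<in>minimizers C (obs_law Kstar \<nu>).
        hausdorff_dist (orbit_Aut C (Ahat n \<omega>)) (orbit_Aut C A)) \<longlonglongrightarrow> 0) \<and>
    (\<forall>Khat. (\<forall>A\<in>minimizers C (obs_law Kstar \<nu>). Khat = (*v) A ` C) \<longrightarrow>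
        (\<forall>p\<ge>1. AE \<omega> in M. (\<lambda>n. rho p ((*v) (Ahat n \<omega>) ` C) Khat) \<longlonglongrightarrow> 0)) \<and>
    (\<forall>Astar :: real^'q^'d. Kstar = (*v) Astar ` C \<longrightarrow>
        (\<forall>p\<ge>1. AE \<omega> in M. (\<lambda>n. rho p ((*v) (Ahat n \<omega>) ` C) Kstar) \<longlonglongrightarrow> 0))"
proof -
  let ?S = "minimizers C (obs_law Kstar \<nu>) :: (real^'q^'d) set"
  note K' = Kstar(3) compact_imp_bounded[OF Kstar(1)]
  note C' = C(3) compact_imp_bounded[OF C(1)]
  have orth: "orthogonal_matrix g" if "g \<in> Aut C" for g
    using subgroup.subset[OF Aut] that by (auto simp: orthogonal_group_mat_def)
  have span: "\<exists>x\<in>C. x \<bullet> v \<noteq> 0" if "v \<noteq> 0" for v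
    using Aut_orthogonal_imp_spanning[OF orth that] .
  have ne: "?S \<noteq> {}"
    and dist: "AE \<omega> in M. (\<lambda>n. infdist (Ahat n \<omega>) ?S) \<longlonglongrightarrow> 0"
    using consistency_minimizers[OF K' C' span noise(1,2,4) M indep law Ahat] by auto
  obtain R where R: "0 < R" "\<And>x. x \<in> C \<Longrightarrow> norm x \<le> R"
    using C'(2) by (auto simp: bounded_pos)
  have orbit: "AE \<omega> in M. (\<lambda>n. INF A\<in>?S. hausdorff_dist (orbit_Aut C (Ahat n \<omega>)) (orbit_Aut C A)) \<longlonglongrightarrow> 0"
    using dist
  proof eventually_elim
    case (elim \<omega>)
    show ?case
    proof (rule tendsto_sandwich[OF _ _ tendsto_const elim]; intro always_eventually allI)
      fix n
      show "0 \<le> (INF A\<in>?S. hausdorff_dist (orbit_Aut C (Ahat n \<omega>)) (orbit_Aut C A))"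
        using ne hausdorff_dist_orbit_le(1)[OF orth] by (rule cINF_greatest)
      show "(INF A\<in>?S. hausdorff_dist (orbit_Aut C (Ahat n \<omega>)) (orbit_Aut C A)) \<le> infdist (Ahat n \<omega>) ?S"
        unfolding infdist_notempty[OF ne]
      proof (rule cINF_mono[OF ne bdd_belowI2])
        show "0 \<le> hausdorff_dist (orbit_Aut C (Ahat n \<omega>)) (orbit_Aut C A)" for A
          by (rule hausdorff_dist_orbit_le(1)[OF orth])
        show "\<exists>B\<in>?S. hausdorff_dist (orbit_Aut C (Ahat n \<omega>)) (orbit_Aut C B) \<le> dist (Ahat n \<omega>) A"
          if "A \<in> ?S" for A
          using that hausdorff_dist_orbit_le(2)[OF orth] by blast
      qed
    qed
  qed
  have rho: "AE \<omega> in M. (\<lambda>n. rho p ((*v) (Ahat n \<omega>) ` C) L) \<longlonglongrightarrow> 0"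
    if p: "1 \<le> p" and L: "\<And>A u. A \<in> ?S \<Longrightarrow> u \<in> sphere 0 1 \<Longrightarrow> support_fun C (transpose A *v u) = support_fun L u"
    for p L
    using dist
  proof eventually_elim
    case (elim \<omega>)
    define c where "c = max 1 (measure (sphere_measure :: (real^'d) measure) (sphere 0 1) powr (1 / real_of_ereal p))"
    have le: "\<bar>support_fun ((*v) (Ahat n \<omega>) ` C) u - support_fun L u\<bar> \<le> R * infdist (Ahat n \<omega>) ?S"
      if u: "u \<in> sphere 0 1" for n u
    proof (rule le_mult_infdist[OF ne R(1)])
      fix A assume A: "A \<in> ?S"
      show "\<bar>support_fun ((*v) (Ahat n \<omega>) ` C) u - support_fun L u\<bar> \<le> R * dist (Ahat n \<omega>) A"
        unfolding support_fun_linear_image L[OF A u, symmetric] dist_norm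
        using u by (intro support_fun_matrix_lipschitz C' R) auto
    qed
    have nn: "0 \<le> R * infdist (Ahat n \<omega>) ?S" for n
      using R(1) by (simp add: infdist_nonneg)
    have "(\<lambda>n. R * infdist (Ahat n \<omega>) ?S * c) \<longlonglongrightarrow> R * 0 * c"
      by (intro tendsto_intros elim)
    then have lim: "(\<lambda>n. R * infdist (Ahat n \<omega>) ?S * c) \<longlonglongrightarrow> 0" by simp
    show ?case
      by (rule tendsto_sandwich[OF _ _ tendsto_const lim])
        (use rho_le[OF p nn le] in \<open>auto simp: c_def\<close>)
  qed
  have exact: "support_fun C (transpose A *v u) = support_fun Kstar u"
    if Astar: "Kstar = (*v) Astar ` C" and A: "A \<in> ?S" and u: "u \<in> sphere 0 1"
    for Astar A :: "real^'q^'d" and u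
  proof -
    let ?g = "\<lambda>A u. support_fun C (transpose A *v u) - support_fun Kstar u"
    interpret U: prob_space "uniform_sphere :: (real^'d) measure" by (rule prob_space_uniform_sphere)
    have cont: "continuous_on UNIV (?g A)"
      by (intro continuous_on_diff continuous_on_support_fun_matrix continuous_on_support_fun K' C')
    then have "?g A \<in> borel_measurable borel"
      by (rule borel_measurable_continuous_onI)
    then have [measurable]: "?g A \<in> borel_measurable (restrict_space borel (sphere 0 1))"
      by (rule measurable_restrict_space1)
    have bound: "\<bar>?g A u\<bar> \<le> R * norm (A - Astar)" if "u \<in> sphere 0 1" for u
      unfolding Astar support_fun_linear_image
      using that by (intro support_fun_matrix_lipschitz C' R) auto
    have int: "integrable uniform_sphere (\<lambda>u. (?g A u)\<^sup>2)"
    proof (rule U.integrable_const_bound)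
      show "AE u in uniform_sphere. norm ((?g A u)\<^sup>2) \<le> (R * norm (A - Astar))\<^sup>2"
        using power_mono[OF bound, of _ 2] by (intro AE_I2) simp
    qed measurable
    have "loss C A (obs_law Kstar \<nu>) \<le> loss C Astar (obs_law Kstar \<nu>)"
      using A by (auto simp: minimizers_def is_arg_min_def not_less)
    moreover have "?g Astar u = 0" for u
      unfolding Astar support_fun_linear_image by simp
    ultimately have "(LINT u|uniform_sphere. (?g A u)\<^sup>2) \<le> 0"
      unfolding loss_obs_law[OF K' noise(1-5) C'] by simp
    then have "(LINT u|uniform_sphere. (?g A u)\<^sup>2) = 0"
      by (intro antisym Bochner_Integration.integral_nonneg) auto
    then have "AE u in uniform_sphere. ?g A u = 0"
      using integral_nonneg_eq_0_iff_AE[OF int] by simp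
    from AE_uniform_sphere_continuous[OF cont this u] show ?thesis by simp
  qed
  show ?thesis
  proof (intro conjI allI impI dist orbit)
    fix Khat and p :: ereal assume Khat: "\<forall>A\<in>?S. Khat = (*v) A ` C" and p: "1 \<le> p"
    show "AE \<omega> in M. (\<lambda>n. rho p ((*v) (Ahat n \<omega>) ` C) Khat) \<longlonglongrightarrow> 0"
    proof (rule rho[OF p])
      fix A u assume "A \<in> ?S"
      with Khat have "Khat = (*v) A ` C" by blast
      then show "support_fun C (transpose A *v u) = support_fun Khat u"
        by (simp only: support_fun_linear_image)
    qed
  next
    fix Astar :: "real^'q^'d" and p :: ereal assume "Kstar = (*v) Astar ` C" "1 \<le> p"
    then show "AE \<omega> in M. (\<lambda>n. rho p ((*v) (Ahat n \<omega>) ` C) Kstar) \<longlonglongrightarrow> 0"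
      by (intro rho exact)
  qed
qed

end
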